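(* Let $M$ be a compact, orientable, triangulated $2$-manifold with finite triangulation $\Delta$, ordered vertices, and fundamental class $[M]=\sum_T\epsilon_1(T)\,T$. Let $D_1(\varphi)$ (dual cell chain), $D_2(\varphi)=\varphi\cap[M]$ (cap product) and $D_3(\varphi)$ (sum of oriented level curves) be associated to each simplicial $1$-cocycle $\varphi$ as defined in the context. Then $D_1$, $D_2$ and $D_3$ are equal when regarded as mappings from $\operatorname{Ker}\delta$ (the group of simplicial $1$-cocycles of $\Delta$ with coefficients in $\mathbb{Z}$) to $H_1(M;\mathbb{Z})$. That is, for every $1$-cocycle $\varphi$, the chains $D_1(\varphi)$, $D_2(\varphi)$, $D_3(\varphi)$ are $1$-cycles representing the same class in $H_1(M;\mathbb{Z})$.
   Context: Setting. $M$ is a compact orientable $2$-manifold with a finite triangulation $\Delta$; all coefficients are $\mathbb{Z}$. The vertices of $\Delta$ are ordered, and simplices are written with vertices in increasing order, so a triangle is $T=[v_0,v_1,v_2]$ with $v_0<v_1<v_2$ and an edge is $[v_i,v_j]$ with $v_i<v_j$. Orientability means that there are signs $\epsilon_1(T)=\pm1$, one for each triangle $T$, such that $[M]=\sum_T\epsilon_1(T)\,T$ is a $2$-cycle; its class generates $H_2(M;\mathbb{Z})$ and is a fundamental class. These signs are fixed; they orient $M$ (each $T$ has the orientation given by its vertex order if $\epsilon_1(T)=1$, and the opposite one otherwise). A simplicial $1$-cochain $\varphi$ is a cocycle ($\varphi\in\operatorname{Ker}\delta$) iff $\varphi([v_0,v_2])=\varphi([v_0,v_1])+\varphi([v_1,v_2])$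 for every triangle $[v_0,v_1,v_2]$. $H_1(M;\mathbb{Z})$ is singular homology; simplicial chains, chains of the barycentric subdivision, and oriented closed curves are regarded as singular chains. $D_1$: for a triangle $T$ and an edge $S$ of $T$, with barycenters $b_T$, $b_S$, let $S_T^*=[b_S,b_T]$ be the segment of the barycentric subdivision oriented from $b_S$ to $b_T$. Let $\epsilon_2(S,T)$ be the sign of $S$ in $\partial T=[v_1,v_2]-[v_0,v_2]+[v_0,v_1]$. Then $D_1(\varphi)=\sum_T\sum_{S\text{ edge of }T}\epsilon_1(T)\,\epsilon_2(S,T)\,\varphi(S)\,S_T^*$. $D_2$: $D_2(\varphi)=\varphi\cap[M]=\sum_{T=[v_0,v_1,v_2]}\epsilon_1(T)\,\varphi([v_0,v_1])\,[v_1,v_2]$. $D_3$: let $\varphi$ be a $1$-cocycle. On each triangle $T$, choose an altitude $\psi_T$ from the vertices of $T$ to $\mathbb{Z}$ with $\psi_T(v_j)-\psi_T(v_i)=\varphi([v_i,v_j])$ for each edge $[v_i,v_j]$ of $T$ (unique up to an additive integer), and extend it affinely to $T$ (viewed as a Euclidean triangle). The level curves in $T$ are the segments on which $\psi_T=m+\tfrac12$ for some $m\in\mathbb{Z}$. Each is oriented so that (normal pointing toward increasing $\psi_T$, direction of the curve) is a positively oriented basis for the orientation of $M$, i.e. the direction is the normal rotated by $+\pi/2$. Along common edges these oriented segments match up, and they form a finite family of disjoint oriented closed loops in $M$. $D_3(\varphi)$ is the $1$-cycle that is the sum of these loops. *)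

theory Defs
  imports "HOL-Analysis.Analysis" "HOL-Homology.Homology"
begin

definition topological_manifold :: "nat \<Rightarrow> 'a topology \<Rightarrow> bool" where
  "topological_manifold n X \<longleftrightarrow>
     Hausdorff_space X \<and> second_countable X \<and>
     (\<forall>x \<in> topspace X. \<exists>U V. openin X U \<and> x \<in> U \<and> openin (Euclidean_space n) V \<and>
        subtopology X U homeomorphic_space subtopology (Euclidean_space n) V)"

text \<open>
  A triangulation of a space \<open>X\<close> is a geometric simplicial complex \<open>K\<close> in some Euclidean space
  together with a homeomorphism \<open>h\<close> from its polyhedron \<open>\<Union>K\<close> onto \<open>X\<close>. The vertices are ordered by
  a linear order relation \<open>r\<close> (reflexive, as in \<open>linear_order_on\<close>). Edges and triangles are
  represented by the increasing tuples of their vertices.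
\<close>

definition vertices :: "'e::euclidean_space set set \<Rightarrow> 'e set" where
  "vertices K = {v. {v} \<in> K}"

definition triangles :: "'e::euclidean_space set set \<Rightarrow> ('e \<times> 'e) set \<Rightarrow> ('e \<times> 'e \<times> 'e) set" where
  "triangles K r = {(v0, v1, v2). v0 \<noteq> v1 \<and> v1 \<noteq> v2 \<and> (v0, v1) \<in> r \<and> (v1, v2) \<in> r \<and>
     convex hull {v0, v1, v2} \<in> K \<and> 2 simplex (convex hull {v0, v1, v2})}"

fun edges_of :: "'e \<times> 'e \<times> 'e \<Rightarrow> ('e \<times> 'e) set" where
  "edges_of (v0, v1, v2) = {(v0, v1), (v0, v2), (v1, v2)}"

fun triangle_hull :: "'e::euclidean_space \<times> 'e \<times> 'e \<Rightarrow> 'e set" where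
  "triangle_hull (v0, v1, v2) = convex hull {v0, v1, v2}"

fun edge_barycenter :: "'e::euclidean_space \<times> 'e \<Rightarrow> 'e" where
  "edge_barycenter (v, w) = (1 / 2) *\<^sub>R (v + w)"

fun triangle_barycenter :: "'e::euclidean_space \<times> 'e \<times> 'e \<Rightarrow> 'e" where
  "triangle_barycenter (v0, v1, v2) = (1 / 3) *\<^sub>R (v0 + v1 + v2)"

text \<open>The coefficient of an edge in \<open>\<partial>[v0, v1, v2] = [v1, v2] - [v0, v2] + [v0, v1]\<close>.\<close>

fun incidence :: "'e \<times> 'e \<Rightarrow> 'e \<times> 'e \<times> 'e \<Rightarrow> int" where
  "incidence S (v0, v1, v2) =
     (if S = (v1, v2) then 1 else if S = (v0, v2) then - 1 else if S = (v0, v1) then 1 else 0)"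

text \<open>
  The straight simplex \<open>[w\<^sub>0, \<dots>, w\<^sub>p]\<close> of the polyhedron as a singular \<open>p\<close>-simplex of \<open>X\<close>, where
  \<open>p + 1\<close> is the length of the list.
\<close>

definition straight :: "('e::euclidean_space \<Rightarrow> 'a) \<Rightarrow> 'e list \<Rightarrow> 'a chain" where
  "straight h ws = frag_of (restrict (\<lambda>x. h (\<Sum>j<length ws. x j *\<^sub>R ws ! j))
                                     (standard_simplex (length ws - 1)))"

definition fundamental_chain ::
  "('e::euclidean_space \<Rightarrow> 'a) \<Rightarrow> ('e \<times> 'e \<times> 'e) set \<Rightarrow> ('e \<times> 'e \<times> 'e \<Rightarrow> int) \<Rightarrow> 'a chain" where
  "fundamental_chain h Ts \<epsilon> =
     (\<Sum>(v0, v1, v2) \<in> Ts. frag_cmul (\<epsilon> (v0, v1, v2)) (straight h [v0, v1, v2]))"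

text \<open>
  A cochain is a function on increasing pairs; its values at pairs that are not edges are irrelevant.
\<close>

definition cocycles :: "('e \<times> 'e \<times> 'e) set \<Rightarrow> ('e \<times> 'e \<Rightarrow> int) set" where
  "cocycles Ts = {\<phi>. \<forall>(v0, v1, v2) \<in> Ts. \<phi> (v0, v2) = \<phi> (v0, v1) + \<phi> (v1, v2)}"

definition D1 ::
  "('e::euclidean_space \<Rightarrow> 'a) \<Rightarrow> ('e \<times> 'e \<times> 'e) set \<Rightarrow> ('e \<times> 'e \<times> 'e \<Rightarrow> int) \<Rightarrow>
   ('e \<times> 'e \<Rightarrow> int) \<Rightarrow> 'a chain" where
  "D1 h Ts \<epsilon> \<phi> =
     (\<Sum>T \<in> Ts. \<Sum>S \<in> edges_of T.
        frag_cmul (\<epsilon> T * incidence S T * \<phi> S)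
                  (straight h [edge_barycenter S, triangle_barycenter T]))"

definition D2 ::
  "('e::euclidean_space \<Rightarrow> 'a) \<Rightarrow> ('e \<times> 'e \<times> 'e) set \<Rightarrow> ('e \<times> 'e \<times> 'e \<Rightarrow> int) \<Rightarrow>
   ('e \<times> 'e \<Rightarrow> int) \<Rightarrow> 'a chain" where
  "D2 h Ts \<epsilon> \<phi> =
     (\<Sum>(v0, v1, v2) \<in> Ts. frag_cmul (\<epsilon> (v0, v1, v2) * \<phi> (v0, v1)) (straight h [v1, v2]))"

definition affine_on_convex :: "'e::real_vector set \<Rightarrow> ('e \<Rightarrow> real) \<Rightarrow> bool" where
  "affine_on_convex A f \<longleftrightarrow>
     (\<forall>x \<in> A. \<forall>y \<in> A. \<forall>u \<in> {0..1}. f ((1 - u) *\<^sub>R x + u *\<^sub>R y) = (1 - u) * f x + u * f y)"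

fun altitude :: "('e \<times> 'e \<Rightarrow> int) \<Rightarrow> 'e::euclidean_space \<times> 'e \<times> 'e \<Rightarrow> ('e \<Rightarrow> real) \<Rightarrow> bool" where
  "altitude \<phi> (v0, v1, v2) \<psi> \<longleftrightarrow>
     \<psi> ` {v0, v1, v2} \<subseteq> \<int> \<and>
     (\<forall>(v, w) \<in> edges_of (v0, v1, v2). \<psi> w - \<psi> v = of_int (\<phi> (v, w))) \<and>
     affine_on_convex (convex hull {v0, v1, v2}) \<psi>"

text \<open>
  \<open>(x, y)\<close> is a positively oriented basis of the plane of \<open>T\<close>, where this plane is oriented by
  \<open>(v1 - v0, v2 - v0)\<close> if \<open>s = 1\<close> and oppositely if \<open>s = -1\<close>.
\<close>

fun positive_basis :: "int \<Rightarrow> 'e::euclidean_space \<times> 'e \<times> 'e \<Rightarrow> 'e \<Rightarrow> 'e \<Rightarrow> bool" where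
  "positive_basis s (v0, v1, v2) x y \<longleftrightarrow>
     (\<exists>a b c d. x = a *\<^sub>R (v1 - v0) + b *\<^sub>R (v2 - v0) \<and>
                y = c *\<^sub>R (v1 - v0) + d *\<^sub>R (v2 - v0) \<and>
                of_int s * (a * d - b * c) > (0 :: real))"

text \<open>
  \<open>(p, q)\<close> stands for the level segment from \<open>p\<close> to \<open>q\<close>. The vector \<open>n\<close> is the gradient of \<open>\<psi>\<close> on \<open>T\<close>
  (\<open>positive_basis\<close> puts it in the plane of \<open>T\<close>), hence the normal pointing toward increasing \<open>\<psi>\<close>.
  Altitudes of \<open>T\<close> differ by integers, so all choices of \<open>\<psi>\<close> give the same segments. As \<open>\<psi>\<close> is
  integral at the vertices, a nonempty level set at \<open>m + 1/2\<close> is a nondegenerate segment.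
\<close>

definition level_segments ::
  "('e::euclidean_space \<times> 'e \<times> 'e) set \<Rightarrow> ('e \<times> 'e \<times> 'e \<Rightarrow> int) \<Rightarrow> ('e \<times> 'e \<Rightarrow> int) \<Rightarrow>
   ('e \<times> 'e) set" where
  "level_segments Ts \<epsilon> \<phi> =
     {(p, q). \<exists>T \<in> Ts. \<exists>\<psi> (m::int) n.
        altitude \<phi> T \<psi> \<and>
        closed_segment p q = {x \<in> triangle_hull T. \<psi> x = of_int m + 1 / 2} \<and>
        (\<forall>x \<in> triangle_hull T. \<forall>y \<in> triangle_hull T. \<psi> y - \<psi> x = n \<bullet> (y - x)) \<and>
        positive_basis (\<epsilon> T) T n (q - p)}"

text \<open>
  An oriented closed polygon is given by the list of its successive corners
  \<open>p\<^sub>0, \<dots>, p\<^sub>k\<close>; its oriented sides are \<open>(p\<^sub>0, p\<^sub>1), \<dots>, (p\<^sub>k, p\<^sub>0)\<close>.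
\<close>

definition loop_sides :: "'e list \<Rightarrow> ('e \<times> 'e) set" where
  "loop_sides ps = set (zip ps (rotate1 ps))"

definition loop_image :: "'e::euclidean_space list \<Rightarrow> 'e set" where
  "loop_image ps = (\<Union>(p, q) \<in> loop_sides ps. closed_segment p q)"

definition loop_chain :: "('e::euclidean_space \<Rightarrow> 'a) \<Rightarrow> 'e list \<Rightarrow> 'a chain" where
  "loop_chain h ps = (\<Sum>(p, q) \<in> loop_sides ps. straight h [p, q])"

text \<open>
  \<open>\<Gamma>\<close> is a family of disjoint oriented closed loops formed by the oriented level segments. It is
  determined up to the choice of the starting corner of each loop.
\<close>

definition level_loops ::
  "('e::euclidean_space \<times> 'e \<times> 'e) set \<Rightarrow> ('e \<times> 'e \<times> 'e \<Rightarrow> int) \<Rightarrow> ('e \<times> 'e \<Rightarrow> int) \<Rightarrow>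
   'e list set \<Rightarrow> bool" where
  "level_loops Ts \<epsilon> \<phi> \<Gamma> \<longleftrightarrow>
     finite \<Gamma> \<and>
     (\<forall>ps \<in> \<Gamma>. ps \<noteq> [] \<and> distinct ps) \<and>
     (\<forall>ps \<in> \<Gamma>. \<forall>qs \<in> \<Gamma>. ps \<noteq> qs \<longrightarrow> loop_image ps \<inter> loop_image qs = {}) \<and>
     (\<Union>ps \<in> \<Gamma>. loop_sides ps) = level_segments Ts \<epsilon> \<phi>"

definition D3 :: "('e::euclidean_space \<Rightarrow> 'a) \<Rightarrow> 'e list set \<Rightarrow> 'a chain" where
  "D3 h \<Gamma> = (\<Sum>ps \<in> \<Gamma>. loop_chain h ps)"

end

theory Submission
  imports Defs "HOL-Combinatorics.Cycles"
begin

text \<open>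
  All three chains are spreads of the cocycle \<open>\<phi>\<close> over points of the edges. Suppose that the value
  \<open>\<phi> S\<close> of each edge \<open>S\<close> is distributed as integral masses \<open>g S x\<close> over finitely many points \<open>x\<close> of
  \<open>S\<close>. In every triangle \<open>T\<close>, join these points to the barycenter \<open>b\<^sub>T\<close> and form
  \<open>- \<Sum>\<^sub>T \<Sum>\<^sub>S \<epsilon> T * [S : T] * \<Sum>\<^sub>x g S x * [b\<^sub>T, x]\<close>. The homology class of this chain does not depend
  on the masses: moving mass along \<open>S\<close> from \<open>x\<close> to \<open>x'\<close> changes each spoke \<open>[b\<^sub>T, x]\<close> by the segment
  \<open>[x, x']\<close> up to a boundary, and this segment then occurs with total coefficient
  \<open>\<Sum>\<^sub>T \<epsilon> T * [S : T]\<close>, which is zero because \<open>\<Sum>\<^sub>T \<epsilon> T * T\<close> is a cycle.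

  If all mass sits at the barycenters of the edges, the result is \<open>D1\<close>; the segments from the edge
  barycenters to \<open>b\<^sub>T\<close> are the spokes reversed. If all mass sits at the last vertex of each edge, the
  cocycle condition turns the contribution of \<open>[v0, v1, v2]\<close> into
  \<open>\<epsilon> * \<phi> [v0, v1] * ([b\<^sub>T, v2] - [b\<^sub>T, v1])\<close>, which is homologous to the contribution of this triangle
  to \<open>D2\<close>. If the mass \<open>sgn (\<phi> S)\<close> is put at each of the \<open>\<bar>\<phi> S\<bar>\<close> points where the altitude takes a
  half-integral value on \<open>S\<close>, the result is \<open>D3\<close>: an oriented level segment from \<open>p\<close> to \<open>q\<close> is
  homologous to \<open>[b\<^sub>T, q] - [b\<^sub>T, p]\<close>. What makes this work is that, going around the oriented boundary
  of \<open>T\<close>, the start points of the level segments are precisely the half-integral points at which the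
  altitude rises, and the end points those at which it falls (\<open>bij_betw_starts\<close>, \<open>bij_betw_ends\<close>).

  The level segments close up to disjoint loops because each edge of a triangle lies in exactly two
  triangles, which induce opposite orientations on it. There are at most two, since two half discs
  glued along an edge are an open subset of the surface by invariance of domain
  (\<open>surface_edge_in_two_triangles\<close>); and a single triangle, or two with the same orientation, would
  contribute to the boundary of the fundamental cycle. So every half-integral point on an edge starts
  exactly one level segment and ends exactly one, and the level segments are the cycles of a
  permutation. Different level segments meet in common end points at most, so these cycles are
  disjoint loops.
\<close>

section \<open>Straight singular simplices\<close>

lemma straight_in_convex_hull:
  assumes x: "x \<in> standard_simplex (length ws - 1)" and ws: "ws \<noteq> []"
  shows "(\<Sum>j<length ws. x j *\<^sub>R ws ! j) \<in> convex hull (set ws)"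
proof (rule convex_sum)
  have "{..<length ws} = {..length ws - 1}"
    using ws by (auto simp: Suc_le_eq neq_Nil_conv)
  then show "(\<Sum>j<length ws. x j) = 1"
    using x by (simp add: standard_simplex_def)
qed (use x in \<open>auto simp: standard_simplex_def intro: hull_inc\<close>)

lemma singular_chain_straight:
  assumes h: "continuous_map (top_of_set P) X h"
    and P: "convex hull (set ws) \<subseteq> P" and ws: "ws \<noteq> []"
  shows "singular_chain (length ws - 1) X (straight h ws)"
proof -
  let ?D = "subtopology (powertop_real UNIV) (standard_simplex (length ws - 1))"
  let ?s = "\<lambda>x. \<Sum>j<length ws. x j *\<^sub>R ws ! j"
  have "continuous_on (standard_simplex (length ws - 1)) ?s"
    by (intro continuous_intros continuous_on_product_coordinates[THEN continuous_on_subset]) auto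
  then have "continuous_map ?D euclidean ?s"
    by (simp add: euclidean_product_topology)
  moreover have "?s \<in> topspace ?D \<rightarrow> P"
    using straight_in_convex_hull[OF _ ws] P by auto
  ultimately have "continuous_map ?D (top_of_set P) ?s"
    by (simp add: continuous_map_in_subtopology)
  then have "continuous_map ?D X (h \<circ> ?s)"
    using h by (rule continuous_map_compose)
  then have "continuous_map ?D X (restrict (h \<circ> ?s) (standard_simplex (length ws - 1)))"
    by (rule continuous_map_eq) auto
  then show ?thesis
    unfolding straight_def singular_chain_of singular_simplex_def
    by (auto simp: o_def)
qed

text \<open>
  Omitting a vertex of a straight simplex leaves a straight simplex, also as a singular simplex with
  its canonical extension outside the standard simplex. So boundaries of straight simplices can be
  computed with lists of vertices.
\<close>
lemma singular_face_straight:
  assumes "k \<le> Suc p" "length ws = Suc (Suc p)"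
  shows "frag_of (singular_face (Suc p) k
           (restrict (\<lambda>x. h (\<Sum>j<length ws. x j *\<^sub>R ws ! j)) (standard_simplex (Suc p)))) =
         straight h (take k ws @ drop (Suc k) ws)"
proof -
  have "(\<Sum>j<Suc (Suc p). simplical_face k x j *\<^sub>R ws ! j) =
        (\<Sum>j<Suc p. x j *\<^sub>R (take k ws @ drop (Suc k) ws) ! j)" for x :: "nat \<Rightarrow> real"
  proof -
    have "(\<Sum>j<Suc (Suc p). simplical_face k x j *\<^sub>R ws ! j) =
          (\<Sum>j\<in>{..<k} \<union> {k<..<Suc (Suc p)}. simplical_face k x j *\<^sub>R ws ! j)"
      by (rule sum.mono_neutral_right) (use assms in \<open>auto simp: simplical_face_def\<close>)
    also have "\<dots> = (\<Sum>j<k. x j *\<^sub>R ws ! j) + (\<Sum>j\<in>{k<..<Suc (Suc p)}. x (j - 1) *\<^sub>R ws ! j)"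
      by (subst sum.union_disjoint) (auto simp: simplical_face_def)
    also have "(\<Sum>j\<in>{k<..<Suc (Suc p)}. x (j - 1) *\<^sub>R ws ! j) = (\<Sum>j\<in>{k..<Suc p}. x j *\<^sub>R ws ! Suc j)"
      by (rule sum.reindex_bij_witness[where i = Suc and j = "\<lambda>j. j - 1"]) auto
    also have "(\<Sum>j<k. x j *\<^sub>R ws ! j) + \<dots> =
        (\<Sum>j\<in>{..<k} \<union> {k..<Suc p}. x j *\<^sub>R (take k ws @ drop (Suc k) ws) ! j)"
      by (subst sum.union_disjoint)
         (use assms in \<open>auto simp: nth_append intro!: sum.cong arg_cong2[where f = "(+)"]\<close>)
    also have "{..<k} \<union> {k..<Suc p} = {..<Suc p}"
      using assms by auto
    finally show ?thesis .
  qed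
  then show ?thesis
    using assms simplical_face_in_standard_simplex[of "Suc p" k]
    by (auto simp: straight_def singular_face_def frag_of_eq min_def simp del: sum.lessThan_Suc)
qed

lemma chain_boundary_straight_edge:
  "chain_boundary 1 (straight h [a, b]) = straight h [b] - straight h [a]"
  using singular_face_straight[of 0 0 "[a, b]" h] singular_face_straight[of 1 0 "[a, b]" h]
  by (simp add: straight_def[of h "[a, b]"] chain_boundary_of)

lemma chain_boundary_straight_triangle:
  "chain_boundary 2 (straight h [a, b, c]) =
     straight h [b, c] - straight h [a, c] + straight h [a, b]"
  using singular_face_straight[of 0 1 "[a, b, c]" h] singular_face_straight[of 1 1 "[a, b, c]" h]
    singular_face_straight[of 2 1 "[a, b, c]" h]
  by (simp add: straight_def[of h "[a, b, c]"] chain_boundary_of numeral_2_eq_2)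

text \<open>
  The difference of the two sides is the boundary of the straight triangle \<open>[c, a, b]\<close>. This one
  relation produces all homologies below.
\<close>
lemma straight_edge_homologous_two_spokes:
  assumes h: "continuous_map (top_of_set P) X h" and P: "convex hull {c, a, b} \<subseteq> P"
  shows "homologous_rel 1 X {} (straight h [a, b]) (straight h [c, b] - straight h [c, a])"
proof -
  have "singular_chain 2 X (straight h [c, a, b])"
    using singular_chain_straight[OF h, of "[c, a, b]"] P by (simp add: numeral_2_eq_2)
  then have "singular_relboundary 1 X {} (chain_boundary 2 (straight h [c, a, b]))"
    by (auto simp: singular_boundary numeral_2_eq_2)
  then show ?thesis
    by (simp add: homologous_rel_def chain_boundary_straight_triangle algebra_simps)
qed

lemma straight_eq_iff:
  assumes "inj_on h P" "closed_segment a b \<subseteq> P" "closed_segment a' b' \<subseteq> P"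
  shows "straight h [a, b] = straight h [a', b'] \<longleftrightarrow> a = a' \<and> b = b'"
proof
  assume eq: "straight h [a, b] = straight h [a', b']"
  let ?e = "\<lambda>i j. if j = (i::nat) then 1 else 0 :: real"
  have *: "h (\<Sum>j<2. ?e i j *\<^sub>R [a, b] ! j) = h (\<Sum>j<2. ?e i j *\<^sub>R [a', b'] ! j)" if "i \<le> 1" for i
    using fun_cong[OF eq[unfolded straight_def frag_of_eq], of "?e i"] that
    by (simp add: basis_in_standard_simplex numeral_2_eq_2)
  have "h a = h a'" "h b = h b'"
    using *[of 0] *[of 1] by (simp_all add: numeral_2_eq_2)
  then show "a = a' \<and> b = b'"
    using assms by (auto dest: inj_onD)
qed simp

section \<open>Spreading a cocycle over points of the edges\<close>

text \<open>
  The setting of the homological part of the argument: \<open>P\<close> is the polyhedron, \<open>h\<close> maps it to the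
  surface, and \<open>\<epsilon>\<close> gives the coefficients of the fundamental chain.
\<close>
locale triangle_system =
  fixes X :: "'a topology"
    and P :: "'e::euclidean_space set"
    and h :: "'e \<Rightarrow> 'a"
    and Ts :: "('e \<times> 'e \<times> 'e) set"
    and \<epsilon> :: "'e \<times> 'e \<times> 'e \<Rightarrow> int"
  assumes continuous: "continuous_map (top_of_set P) X h"
    and finite_triangles: "finite Ts"
    and distinct_corners: "(v0, v1, v2) \<in> Ts \<Longrightarrow> distinct [v0, v1, v2]"
    and triangle_subset: "T \<in> Ts \<Longrightarrow> triangle_hull T \<subseteq> P"
begin

lemma finite_edges_of: "finite (edges_of T)"
  by (cases T) auto

lemma sum_edges_of:
  fixes F :: "'e \<times> 'e \<Rightarrow> 'b::comm_monoid_add"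
  assumes "(v0, v1, v2) \<in> Ts"
  shows "(\<Sum>S\<in>edges_of (v0, v1, v2). F S) = F (v0, v1) + F (v0, v2) + F (v1, v2)"
  using distinct_corners[OF assms] by (auto simp: add.assoc)

lemma incidence_edges:
  assumes "(v0, v1, v2) \<in> Ts"
  shows "incidence (v0, v1) (v0, v1, v2) = 1" "incidence (v0, v2) (v0, v1, v2) = - 1"
    "incidence (v1, v2) (v0, v1, v2) = 1"
  using distinct_corners[OF assms] by auto

lemma incidence_outside: "S \<notin> edges_of T \<Longrightarrow> incidence S T = 0"
  by (cases T) auto

lemma sum_over_triangles_and_edges:
  "(\<Sum>T\<in>Ts. \<Sum>S\<in>edges_of T. frag_cmul (\<epsilon> T * incidence S T) (G S)) =
   (\<Sum>S\<in>\<Union> (edges_of ` Ts). frag_cmul (\<Sum>T\<in>Ts. \<epsilon> T * incidence S T) (G S))"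
proof -
  let ?E = "\<Union> (edges_of ` Ts)"
  have fin: "finite ?E"
    using finite_triangles finite_edges_of by auto
  have "(\<Sum>T\<in>Ts. \<Sum>S\<in>edges_of T. frag_cmul (\<epsilon> T * incidence S T) (G S)) =
        (\<Sum>T\<in>Ts. \<Sum>S\<in>?E. frag_cmul (\<epsilon> T * incidence S T) (G S))"
    by (intro sum.cong refl sum.mono_neutral_left) (use fin incidence_outside in auto)
  also have "\<dots> = (\<Sum>S\<in>?E. \<Sum>T\<in>Ts. frag_cmul (\<epsilon> T * incidence S T) (G S))"
    by (rule sum.swap)
  also have "\<dots> = (\<Sum>S\<in>?E. frag_cmul (\<Sum>T\<in>Ts. \<epsilon> T * incidence S T) (G S))"
    by (intro sum.cong refl poly_mapping_eqI) (simp add: lookup_sum sum_distrib_right)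
  finally show ?thesis .
qed

lemma closed_segment_subset_triangle_hull:
  assumes "S \<in> edges_of T"
  shows "closed_segment (fst S) (snd S) \<subseteq> triangle_hull T"
proof (cases T)
  case (fields v0 v1 v2)
  then have "{fst S, snd S} \<subseteq> {v0, v1, v2}"
    using assms by auto
  then show ?thesis
    by (simp add: fields segment_convex_hull hull_mono)
qed

text \<open>
  The straight singular edges of different edges are different generators of the free group of
  singular chains, so the cycle condition can be read off edge by edge.
\<close>
theorem balanced_of_fundamental_cycle:
  assumes inj: "inj_on h P" and cycle: "chain_boundary 2 (fundamental_chain h Ts \<epsilon>) = 0"
  shows "(\<Sum>T\<in>Ts. \<epsilon> T * incidence S T) = 0"
proof (cases "S \<in> \<Union> (edges_of ` Ts)")
  case False
  then show ?thesis
    by (intro sum.neutral) (auto simp: incidence_outside)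
next
  case True
  let ?E = "\<Union> (edges_of ` Ts)" and ?s = "\<lambda>S. straight h [fst S, snd S]"
  have "chain_boundary 2 (fundamental_chain h Ts \<epsilon>) =
        (\<Sum>T\<in>Ts. \<Sum>S\<in>edges_of T. frag_cmul (\<epsilon> T * incidence S T) (?s S))"
    unfolding fundamental_chain_def chain_boundary_sum
  proof (intro sum.cong refl)
    fix T assume T: "T \<in> Ts"
    obtain v0 v1 v2 where T': "T = (v0, v1, v2)"
      by (cases T)
    show "(chain_boundary 2 \<circ> (\<lambda>(v0, v1, v2).
          frag_cmul (\<epsilon> (v0, v1, v2)) (straight h [v0, v1, v2]))) T =
        (\<Sum>S\<in>edges_of T. frag_cmul (\<epsilon> T * incidence S T) (?s S))"
      using T[unfolded T']
      by (intro poly_mapping_eqI)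
         (simp add: T' chain_boundary_cmul chain_boundary_straight_triangle sum_edges_of
            incidence_edges lookup_add lookup_minus algebra_simps
            del: edges_of.simps incidence.simps)
  qed
  then have 0: "(\<Sum>S\<in>?E. frag_cmul (\<Sum>T\<in>Ts. \<epsilon> T * incidence S T) (?s S)) = 0"
    using cycle sum_over_triangles_and_edges[of ?s] by simp
  have fin: "finite ?E"
    using finite_triangles finite_edges_of by auto
  obtain f where f: "?s S = frag_of f"
    by (simp add: straight_def)
  have seg: "closed_segment (fst S) (snd S) \<subseteq> P" if "S \<in> ?E" for S
    using that triangle_subset closed_segment_subset_triangle_hull by blast
  \<comment> \<open>Since \<open>h\<close> is injective, the singular simplex of \<open>S\<close> occurs with this edge only.\<close>
  have "poly_mapping.lookup (?s S') f = (if S' = S then 1 else 0)" if S': "S' \<in> ?E" for S'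
  proof (cases "S' = S")
    case False
    then have "?s S' \<noteq> ?s S"
      using straight_eq_iff[OF inj seg[OF S'] seg[OF True]] by (simp add: prod_eq_iff)
    then show ?thesis
      using False f by (auto simp: straight_def frag_of_eq)
  qed (simp add: f)
  then have "poly_mapping.lookup (\<Sum>S\<in>?E. frag_cmul (\<Sum>T\<in>Ts. \<epsilon> T * incidence S T) (?s S)) f =
      (\<Sum>S'\<in>?E. if S' = S then \<Sum>T\<in>Ts. \<epsilon> T * incidence S' T else 0)"
    unfolding lookup_sum by (intro sum.cong) auto
  then show ?thesis
    using 0 fin True by (simp add: sum.delta)
qed

end

locale balanced_triangles = triangle_system X P h Ts \<epsilon>
  for X :: "'a topology"
    and P :: "'e::euclidean_space set"
    and h :: "'e \<Rightarrow> 'a"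
    and Ts :: "('e \<times> 'e \<times> 'e) set"
    and \<epsilon> :: "'e \<times> 'e \<times> 'e \<Rightarrow> int" +
  assumes balance: "(\<Sum>T\<in>Ts. \<epsilon> T * incidence S T) = 0"
begin

text \<open>
  A chain that depends on the edge only, not on the triangle, contributes nothing after summation
  with the boundary coefficients: this is where neighbouring triangles cancel.
\<close>
lemma sum_over_edges_cancels:
  "(\<Sum>T\<in>Ts. \<Sum>S\<in>edges_of T. frag_cmul (\<epsilon> T * incidence S T) (G S)) = 0"
  by (simp add: sum_over_triangles_and_edges balance)

definition spoke :: "'e \<times> 'e \<times> 'e \<Rightarrow> 'e \<Rightarrow> 'a chain" where
  "spoke T x = straight h [triangle_barycenter T, x]"

text \<open>
  The common form of the three chains: the mass \<open>g S x\<close> sits at the point \<open>x\<close> of the edge \<open>S\<close>, and in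
  each triangle it is carried by the spoke to \<open>x\<close>. The sign makes \<open>D1\<close>, whose segments run towards the
  barycenter, a spread.
\<close>
definition spread ::
  "('e \<times> 'e \<Rightarrow> 'e set) \<Rightarrow> ('e \<times> 'e \<Rightarrow> 'e \<Rightarrow> int) \<Rightarrow> 'a chain" where
  "spread Q g = - (\<Sum>T\<in>Ts. \<Sum>S\<in>edges_of T.
     frag_cmul (\<epsilon> T * incidence S T) (\<Sum>x\<in>Q S. frag_cmul (g S x) (spoke T x)))"

lemma triangle_barycenter_in_hull: "triangle_barycenter T \<in> triangle_hull T"
proof (cases T)
  case (fields v0 v1 v2)
  have "triangle_barycenter T = (1/3) *\<^sub>R v0 + (1/3) *\<^sub>R v1 + (1/3) *\<^sub>R v2"
    by (simp add: fields algebra_simps)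
  then show ?thesis
    unfolding fields triangle_hull.simps convex_hull_3 by force
qed

lemma homologous_spoke_difference:
  assumes T: "T \<in> Ts" and a: "a \<in> triangle_hull T" and b: "b \<in> triangle_hull T"
  shows "homologous_rel 1 X {} (straight h [a, b]) (spoke T b - spoke T a)"
  unfolding spoke_def
proof (rule straight_edge_homologous_two_spokes[OF continuous])
  have "convex (triangle_hull T)"
    by (cases T) auto
  then have "convex hull {triangle_barycenter T, a, b} \<subseteq> triangle_hull T"
    using a b triangle_barycenter_in_hull[of T] by (intro hull_minimal) auto
  then show "convex hull {triangle_barycenter T, a, b} \<subseteq> P"
    using triangle_subset[OF T] by blast
qed

lemma homologous_sum:
  assumes "\<And>i. i \<in> I \<Longrightarrow> homologous_rel p Y {} (f i) (g i)" "finite I"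
  shows "homologous_rel p Y {} (\<Sum>i\<in>I. f i) (\<Sum>i\<in>I. g i)"
  using assms by (intro homologous_rel_sum) auto

lemma frag_cmul_minus_diff: "frag_cmul (- k) (a - b) = - frag_cmul k a + frag_cmul k b"
  by (intro poly_mapping_eqI) (simp add: lookup_add lookup_minus right_diff_distrib)

lemma homologous_cmul:
  assumes "homologous_rel p Y {} a b"
  shows "homologous_rel p Y {} (frag_cmul k a) (frag_cmul k b)"
proof -
  have "frag_cmul k a - frag_cmul k b = frag_cmul k (a - b)"
    by (intro poly_mapping_eqI) (simp add: lookup_minus right_diff_distrib)
  then show ?thesis
    using assms by (simp add: homologous_rel_def singular_relboundary_cmul)
qed

text \<open>
  Up to homology \<open>D2\<close> is the spread with all mass at the last vertices of the edges. Moving the mass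
  from there to the points \<open>Q S\<close> costs the chain \<open>\<Sum>\<^sub>x g S x * [snd S, x]\<close>, which depends on \<open>S\<close>
  only and cancels.
\<close>
theorem D2_homologous_spread:
  assumes \<phi>: "\<phi> \<in> cocycles Ts"
    and Q: "\<And>S T. T \<in> Ts \<Longrightarrow> S \<in> edges_of T \<Longrightarrow>
              finite (Q S) \<and> Q S \<subseteq> closed_segment (fst S) (snd S) \<and> (\<Sum>x\<in>Q S. g S x) = \<phi> S"
  shows "homologous_rel 1 X {} (D2 h Ts \<epsilon> \<phi>) (spread Q g)"
proof -
  let ?G = "\<lambda>S. \<Sum>x\<in>Q S. frag_cmul (g S x) (straight h [snd S, x])"
  let ?A = "\<lambda>T. \<Sum>S\<in>edges_of T. frag_cmul (\<epsilon> T * incidence S T) (frag_cmul (\<phi> S) (spoke T (snd S)))"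
  have 1: "D2 h Ts \<epsilon> \<phi> = (\<Sum>T\<in>Ts. case T of (v0, v1, v2) \<Rightarrow>
             frag_cmul (\<epsilon> T * \<phi> (v0, v1)) (straight h [v1, v2]))"
    by (simp add: D2_def split_def)
  have "homologous_rel 1 X {} (case T of (v0, v1, v2) \<Rightarrow>
          frag_cmul (\<epsilon> T * \<phi> (v0, v1)) (straight h [v1, v2])) (- ?A T)" if T: "T \<in> Ts" for T
  proof (cases T)
    case (fields v0 v1 v2)
    have "\<phi> (v0, v2) = \<phi> (v0, v1) + \<phi> (v1, v2)"
      using \<phi> T fields by (auto simp: cocycles_def)
    then have "- ?A T = frag_cmul (\<epsilon> T * \<phi> (v0, v1)) (spoke T v2 - spoke T v1)"
      using T[unfolded fields]
      by (intro poly_mapping_eqI)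
         (simp add: fields sum_edges_of incidence_edges lookup_add lookup_minus algebra_simps
               del: edges_of.simps incidence.simps)
    moreover have "homologous_rel 1 X {} (straight h [v1, v2]) (spoke T v2 - spoke T v1)"
      by (rule homologous_spoke_difference[OF T]) (auto simp: fields hull_inc)
    ultimately show ?thesis
      using homologous_cmul[of 1 X "straight h [v1, v2]" "spoke T v2 - spoke T v1" "\<epsilon> T * \<phi> (v0, v1)"]
      by (simp only: fields prod.case)
  qed
  then have "homologous_rel 1 X {} (D2 h Ts \<epsilon> \<phi>) (\<Sum>T\<in>Ts. - ?A T)"
    unfolding 1 by (rule homologous_sum[OF _ finite_triangles])
  moreover have "homologous_rel 1 X {} (\<Sum>T\<in>Ts. - ?A T) (\<Sum>T\<in>Ts. \<Sum>S\<in>edges_of T.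
      frag_cmul (- (\<epsilon> T * incidence S T)) ((\<Sum>x\<in>Q S. frag_cmul (g S x) (spoke T x)) - ?G S))"
  proof (rule homologous_sum[OF _ finite_triangles])
    fix T assume T: "T \<in> Ts"
    have "homologous_rel 1 X {} (frag_cmul (\<phi> S) (spoke T (snd S)))
        ((\<Sum>x\<in>Q S. frag_cmul (g S x) (spoke T x)) - ?G S)" if S: "S \<in> edges_of T" for S
    proof -
      have "homologous_rel 1 X {} (spoke T (snd S)) (spoke T x - straight h [snd S, x])"
        if "x \<in> Q S" for x
      proof -
        have "x \<in> triangle_hull T" "snd S \<in> triangle_hull T"
          using that Q[OF T S] closed_segment_subset_triangle_hull[OF S] by auto
        then have "homologous_rel 1 X {} (straight h [snd S, x]) (spoke T x - spoke T (snd S))"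
          using homologous_spoke_difference[OF T] by blast
        then have "homologous_rel 1 X {} (spoke T x - straight h [snd S, x])
                     (spoke T x - (spoke T x - spoke T (snd S)))"
          by (intro homologous_rel_diff) auto
        then show ?thesis
          by (simp add: homologous_rel_sym)
      qed
      then have "homologous_rel 1 X {} (\<Sum>x\<in>Q S. frag_cmul (g S x) (spoke T (snd S)))
          (\<Sum>x\<in>Q S. frag_cmul (g S x) (spoke T x - straight h [snd S, x]))"
        using Q[OF T S] by (intro homologous_sum homologous_cmul) auto
      moreover have "(\<Sum>x\<in>Q S. frag_cmul (g S x) (spoke T (snd S))) = frag_cmul (\<phi> S) (spoke T (snd S))"
        unfolding conjunct2[OF conjunct2[OF Q[OF T S]], symmetric]
        by (intro poly_mapping_eqI) (simp add: lookup_sum sum_distrib_right)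
      moreover have "(\<Sum>x\<in>Q S. frag_cmul (g S x) (spoke T x - straight h [snd S, x])) =
          (\<Sum>x\<in>Q S. frag_cmul (g S x) (spoke T x)) - ?G S"
        by (intro poly_mapping_eqI) (simp add: lookup_sum lookup_minus right_diff_distrib sum_subtractf)
      ultimately show ?thesis
        by simp
    qed
    then have "homologous_rel 1 X {}
        (\<Sum>S\<in>edges_of T. frag_cmul (- (\<epsilon> T * incidence S T)) (frag_cmul (\<phi> S) (spoke T (snd S))))
        (\<Sum>S\<in>edges_of T. frag_cmul (- (\<epsilon> T * incidence S T))
          ((\<Sum>x\<in>Q S. frag_cmul (g S x) (spoke T x)) - ?G S))"
      by (intro homologous_sum homologous_cmul finite_edges_of)
    then show "homologous_rel 1 X {} (- ?A T) (\<Sum>S\<in>edges_of T.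
      frag_cmul (- (\<epsilon> T * incidence S T)) ((\<Sum>x\<in>Q S. frag_cmul (g S x) (spoke T x)) - ?G S))"
      by (simp only: sum_negf[symmetric] minus_frag_cmul)
  qed
  moreover have "(\<Sum>T\<in>Ts. \<Sum>S\<in>edges_of T.
      frag_cmul (- (\<epsilon> T * incidence S T)) ((\<Sum>x\<in>Q S. frag_cmul (g S x) (spoke T x)) - ?G S)) =
      spread Q g + (\<Sum>T\<in>Ts. \<Sum>S\<in>edges_of T. frag_cmul (\<epsilon> T * incidence S T) (?G S))"
    unfolding spread_def
    by (simp only: frag_cmul_minus_diff sum.distrib sum_negf)
  moreover have "\<dots> = spread Q g"
    by (simp only: sum_over_edges_cancels add_0_right)
  ultimately show ?thesis
    by (simp only: homologous_rel_trans)
qed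

text \<open>
  The segment from \<open>b\<^sub>S\<close> to \<open>b\<^sub>T\<close> is homologous to \<open>[b\<^sub>T, b\<^sub>T] - [b\<^sub>T, b\<^sub>S]\<close>. By the cocycle condition the
  coefficients of the degenerate spoke \<open>[b\<^sub>T, b\<^sub>T]\<close> add up to zero.
\<close>
lemma D1_homologous_spread:
  assumes \<phi>: "\<phi> \<in> cocycles Ts"
  shows "homologous_rel 1 X {} (D1 h Ts \<epsilon> \<phi>) (spread (\<lambda>S. {edge_barycenter S}) (\<lambda>S x. \<phi> S))"
proof -
  let ?c = "\<lambda>T S. frag_cmul (\<epsilon> T * incidence S T * \<phi> S)
                  (spoke T (triangle_barycenter T) - spoke T (edge_barycenter S))"
  have "homologous_rel 1 X {} (D1 h Ts \<epsilon> \<phi>) (\<Sum>T\<in>Ts. \<Sum>S\<in>edges_of T. ?c T S)"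
    unfolding D1_def
  proof (intro homologous_sum homologous_cmul finite_triangles finite_edges_of)
    fix T S assume T: "T \<in> Ts" and S: "S \<in> edges_of T"
    have "edge_barycenter S \<in> closed_segment (fst S) (snd S)"
      using midpoint_in_closed_segment by (cases S) (simp add: midpoint_def)
    then show "homologous_rel 1 X {} (straight h [edge_barycenter S, triangle_barycenter T])
        (spoke T (triangle_barycenter T) - spoke T (edge_barycenter S))"
      using closed_segment_subset_triangle_hull[OF S] triangle_barycenter_in_hull[of T]
      by (intro homologous_spoke_difference[OF T]) auto
  qed
  moreover have "(\<Sum>T\<in>Ts. \<Sum>S\<in>edges_of T. ?c T S) =
      (\<Sum>T\<in>Ts. - (\<Sum>S\<in>edges_of T.
        frag_cmul (\<epsilon> T * incidence S T) (frag_cmul (\<phi> S) (spoke T (edge_barycenter S)))))"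
  proof (intro sum.cong refl)
    fix T assume T: "T \<in> Ts"
    obtain v0 v1 v2 where T': "T = (v0, v1, v2)"
      by (cases T)
    have "\<phi> (v0, v2) = \<phi> (v0, v1) + \<phi> (v1, v2)"
      using \<phi> T T' by (auto simp: cocycles_def)
    then show "(\<Sum>S\<in>edges_of T. ?c T S) = - (\<Sum>S\<in>edges_of T.
        frag_cmul (\<epsilon> T * incidence S T) (frag_cmul (\<phi> S) (spoke T (edge_barycenter S))))"
      using T[unfolded T']
      by (intro poly_mapping_eqI)
         (simp add: T' sum_edges_of incidence_edges lookup_add lookup_minus algebra_simps
               del: edges_of.simps incidence.simps triangle_barycenter.simps edge_barycenter.simps)
  qed
  ultimately show ?thesis
    by (simp add: spread_def sum_negf)
qed

theorem D1_homologous_D2: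
  assumes \<phi>: "\<phi> \<in> cocycles Ts"
  shows "homologous_rel 1 X {} (D1 h Ts \<epsilon> \<phi>) (D2 h Ts \<epsilon> \<phi>)"
proof -
  have "edge_barycenter S \<in> closed_segment (fst S) (snd S)" for S :: "'e \<times> 'e"
    using midpoint_in_closed_segment by (cases S) (simp add: midpoint_def)
  then have "homologous_rel 1 X {} (D2 h Ts \<epsilon> \<phi>) (spread (\<lambda>S. {edge_barycenter S}) (\<lambda>S x. \<phi> S))"
    by (intro D2_homologous_spread[OF \<phi>]) auto
  then show ?thesis
    using homologous_rel_trans[OF _ D1_homologous_spread[OF \<phi>]] homologous_rel_sym by blast
qed

lemma singular_relcycle_D2:
  assumes \<phi>: "\<phi> \<in> cocycles Ts"
  shows "singular_relcycle 1 X {} (D2 h Ts \<epsilon> \<phi>)"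
  unfolding singular_cycle
proof
  have "singular_chain 1 X (straight h [v1, v2])" if "(v0, v1, v2) \<in> Ts" for v0 v1 v2
  proof -
    have "convex hull {v1, v2} \<subseteq> P"
      using triangle_subset[OF that] hull_mono[of "{v1, v2}" "{v0, v1, v2}"] by force
    then show ?thesis
      using singular_chain_straight[OF continuous, of "[v1, v2]"] by simp
  qed
  then show "singular_chain 1 X (D2 h Ts \<epsilon> \<phi>)"
    unfolding D2_def by (intro singular_chain_sum) (auto intro!: singular_chain_cmul)
  have "chain_boundary 1 (D2 h Ts \<epsilon> \<phi>) = (\<Sum>T\<in>Ts. - (\<Sum>S\<in>edges_of T.
     frag_cmul (\<epsilon> T * incidence S T) (frag_cmul (\<phi> S) (straight h [snd S]))))"
    unfolding D2_def chain_boundary_sum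
  proof (intro sum.cong refl)
    fix T assume T: "T \<in> Ts"
    obtain v0 v1 v2 where T': "T = (v0, v1, v2)"
      by (cases T)
    have "\<phi> (v0, v2) = \<phi> (v0, v1) + \<phi> (v1, v2)"
      using \<phi> T T' by (auto simp: cocycles_def)
    then show "(chain_boundary 1 \<circ> (\<lambda>(v0, v1, v2).
          frag_cmul (\<epsilon> (v0, v1, v2) * \<phi> (v0, v1)) (straight h [v1, v2]))) T =
        - (\<Sum>S\<in>edges_of T. frag_cmul (\<epsilon> T * incidence S T) (frag_cmul (\<phi> S) (straight h [snd S])))"
      using T[unfolded T']
      by (intro poly_mapping_eqI)
         (simp add: T' chain_boundary_cmul chain_boundary_straight_edge[unfolded One_nat_def] sum_edges_of incidence_edges
             lookup_add lookup_minus algebra_simps del: edges_of.simps incidence.simps)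
  qed
  then show "chain_boundary 1 (D2 h Ts \<epsilon> \<phi>) = 0"
    by (simp only: sum_negf sum_over_edges_cancels minus_zero)
qed

end

section \<open>Level sets in a triangle\<close>

definition nondegenerate :: "'e::real_vector \<Rightarrow> 'e \<Rightarrow> 'e \<Rightarrow> bool" where
  "nondegenerate a b c \<longleftrightarrow>
     (\<forall>x y. x *\<^sub>R (b - a) + y *\<^sub>R (c - a) = 0 \<longrightarrow> x = 0 \<and> y = 0)"

text \<open>
  The point of the line through \<open>a\<close> and \<open>b\<close> on which the linear functional \<open>n\<close> takes the value \<open>l\<close>.
  If \<open>n\<close> agrees on \<open>a\<close> and \<open>b\<close>, the value is \<open>a\<close>.
\<close>
definition cross :: "'e::euclidean_space \<Rightarrow> real \<Rightarrow> 'e \<Rightarrow> 'e \<Rightarrow> 'e" where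
  "cross n l a b = a + ((l - n \<bullet> a) / (n \<bullet> b - n \<bullet> a)) *\<^sub>R (b - a)"

lemma cross_commute:
  assumes "n \<bullet> a \<noteq> n \<bullet> b"
  shows "cross n l a b = cross n l b a"
proof -
  have "(l - n \<bullet> b) / (n \<bullet> a - n \<bullet> b) = 1 - (l - n \<bullet> a) / (n \<bullet> b - n \<bullet> a)"
    using assms by (simp add: field_simps)
  moreover have "a + s *\<^sub>R (b - a) = b + (1 - s) *\<^sub>R (a - b)" for s
    by (simp add: algebra_simps)
  ultimately show ?thesis
    by (simp add: cross_def)
qed

lemma inner_cross:
  assumes "n \<bullet> a \<noteq> n \<bullet> b"
  shows "n \<bullet> cross n l a b = l"
  using assms by (simp add: cross_def inner_add_right inner_diff_right)

lemma cross_parameter: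
  assumes "n \<bullet> a < l \<and> l < n \<bullet> b \<or> n \<bullet> b < l \<and> l < n \<bullet> a"
  shows "\<exists>s. 0 < s \<and> s < 1 \<and> cross n l a b = a + s *\<^sub>R (b - a) \<and>
           s * (n \<bullet> b - n \<bullet> a) = l - n \<bullet> a"
  by (rule exI[of _ "(l - n \<bullet> a) / (n \<bullet> b - n \<bullet> a)"])
     (use assms in \<open>auto simp: cross_def divide_simps\<close>)

text \<open>
  A level that separates the vertices of a triangle and passes through none of them has exactly one
  vertex, \<open>a\<close>, on one of its sides, and the level set runs between the two edges at \<open>a\<close>. This
  formulation covers a rising and a falling functional and is symmetric in the other two vertices.
\<close>
lemma level_set_lone_vertex:
  fixes a b c n :: "'e::euclidean_space"
  assumes sides: "n \<bullet> a < l \<and> l < n \<bullet> b \<and> l < n \<bullet> c \<or> l < n \<bullet> a \<and> n \<bullet> b < l \<and> n \<bullet> c < l"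
  shows "{x \<in> convex hull {a, b, c}. n \<bullet> x = l} = closed_segment (cross n l a b) (cross n l a c)"
proof -
  obtain s where s: "0 < s" "s < 1" "cross n l a b = a + s *\<^sub>R (b - a)" "s * (n \<bullet> b - n \<bullet> a) = l - n \<bullet> a"
    using cross_parameter[of n a l b] sides by blast
  obtain t where t: "0 < t" "t < 1" "cross n l a c = a + t *\<^sub>R (c - a)" "t * (n \<bullet> c - n \<bullet> a) = l - n \<bullet> a"
    using cross_parameter[of n a l c] sides by blast
  show ?thesis
  proof (intro equalityI subsetI)
    fix x assume "x \<in> {x \<in> convex hull {a, b, c}. n \<bullet> x = l}"
    then obtain u v w where uvw: "0 \<le> u" "0 \<le> v" "0 \<le> w" "u + v + w = 1"
      and x: "x = u *\<^sub>R a + v *\<^sub>R b + w *\<^sub>R c" and l: "n \<bullet> x = l"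
      by (auto simp: convex_hull_3)
    have u: "u = 1 - v - w"
      using uvw by simp
    have "v * (n \<bullet> b - n \<bullet> a) + w * (n \<bullet> c - n \<bullet> a) = l - n \<bullet> a"
      using l by (simp add: x u algebra_simps inner_add_right)
    moreover have "(v * t + w * s - s * t) * L = 0"
      if "v * B + w * C = L" "s * B = L" "t * C = L" for B C L
    proof -
      have "(v * t + w * s - s * t) * L = v * t * (s * B) + w * s * (t * C) - s * t * (v * B + w * C)"
        unfolding that by (simp add: algebra_simps)
      then show ?thesis
        by (simp add: algebra_simps)
    qed
    ultimately have "(v * t + w * s - s * t) * (l - n \<bullet> a) = 0"
      using s(4) t(4) by blast
    then have vt: "v * t + w * s = s * t"
      using sides by auto
    then have v: "v = (1 - w / t) * s"
      using t(1) by (simp add: field_simps)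
    then have "0 \<le> 1 - w / t"
      using uvw(2) s(1) by (simp only: v zero_le_mult_iff) auto
    moreover have "x = (1 - w / t) *\<^sub>R cross n l a b + (w / t) *\<^sub>R cross n l a c"
    proof -
      have "(1 - w / t) *\<^sub>R cross n l a b + (w / t) *\<^sub>R cross n l a c =
            a + ((1 - w / t) * s) *\<^sub>R (b - a) + (w / t * t) *\<^sub>R (c - a)"
        unfolding s(3) t(3) by (simp add: algebra_simps)
      also have "\<dots> = x"
        unfolding v[symmetric] x u using t(1) by (simp add: algebra_simps)
      finally show ?thesis by simp
    qed
    ultimately show "x \<in> closed_segment (cross n l a b) (cross n l a c)"
      unfolding closed_segment_def using uvw(3) t(1) by (intro CollectI exI[of _ "w / t"]) auto
  next
    fix x assume x: "x \<in> closed_segment (cross n l a b) (cross n l a c)"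
    have "{x \<in> convex hull {a, b, c}. n \<bullet> x = l} = convex hull {a, b, c} \<inter> {x. n \<bullet> x = l}"
      by blast
    then have "convex {x \<in> convex hull {a, b, c}. n \<bullet> x = l}"
      by (simp add: convex_Int convex_hyperplane)
    moreover have "cross n l a b \<in> convex hull {a, b, c}" "cross n l a c \<in> convex hull {a, b, c}"
    proof -
      have hull: "u *\<^sub>R a + v *\<^sub>R b + w *\<^sub>R c \<in> convex hull {a, b, c}"
        if "0 \<le> u" "0 \<le> v" "0 \<le> w" "u + v + w = 1" for u v w
        unfolding convex_hull_3 using that by blast
      have "cross n l a b = (1 - s) *\<^sub>R a + s *\<^sub>R b + 0 *\<^sub>R c"
        by (simp add: s(3) algebra_simps)
      moreover have "(1 - s) *\<^sub>R a + s *\<^sub>R b + 0 *\<^sub>R c \<in> convex hull {a, b, c}"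
        by (rule hull) (use s in auto)
      ultimately show "cross n l a b \<in> convex hull {a, b, c}"
        by simp
      have "cross n l a c = (1 - t) *\<^sub>R a + 0 *\<^sub>R b + t *\<^sub>R c"
        by (simp add: t(3) algebra_simps)
      moreover have "(1 - t) *\<^sub>R a + 0 *\<^sub>R b + t *\<^sub>R c \<in> convex hull {a, b, c}"
        by (rule hull) (use t in auto)
      ultimately show "cross n l a c \<in> convex hull {a, b, c}"
        by simp
    qed
    moreover have "n \<bullet> cross n l a b = l" "n \<bullet> cross n l a c = l"
      using sides by (auto intro!: inner_cross)
    ultimately have "closed_segment (cross n l a b) (cross n l a c) \<subseteq> {x \<in> convex hull {a, b, c}. n \<bullet> x = l}"
      by (intro closed_segment_subset) simp_all
    then show "x \<in> {x \<in> convex hull {a, b, c}. n \<bullet> x = l}"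
      using x by blast
  qed
qed

lemma open_level_segment_interior:
  fixes a b c n :: "'e::euclidean_space"
  assumes sides: "n \<bullet> a < l \<and> l < n \<bullet> b \<and> l < n \<bullet> c \<or> l < n \<bullet> a \<and> n \<bullet> b < l \<and> n \<bullet> c < l"
    and x: "x \<in> open_segment (cross n l a b) (cross n l a c)"
  shows "\<exists>u v w. 0 < u \<and> 0 < v \<and> 0 < w \<and> u + v + w = 1 \<and> x = u *\<^sub>R a + v *\<^sub>R b + w *\<^sub>R c"
proof -
  obtain s where s: "0 < s" "s < 1" "cross n l a b = a + s *\<^sub>R (b - a)"
    using cross_parameter[of n a l b] sides by blast
  obtain t where t: "0 < t" "t < 1" "cross n l a c = a + t *\<^sub>R (c - a)"
    using cross_parameter[of n a l c] sides by blast
  obtain z where z: "0 < z" "z < 1" and "x = (1 - z) *\<^sub>R cross n l a b + z *\<^sub>R cross n l a c"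
    using x by (auto simp: in_segment)
  then have "x = ((1 - z) * (1 - s) + z * (1 - t)) *\<^sub>R a + ((1 - z) * s) *\<^sub>R b + (z * t) *\<^sub>R c"
    by (simp add: s(3) t(3) algebra_simps)
  moreover have "((1 - z) * (1 - s) + z * (1 - t)) + (1 - z) * s + z * t = 1"
    by (simp add: algebra_simps)
  moreover have "0 < (1 - z) * (1 - s) + z * (1 - t)" "0 < (1 - z) * s" "0 < z * t"
    using z s(1,2) t(1,2) by (auto intro!: add_pos_pos mult_pos_pos)
  ultimately show ?thesis by blast
qed

section \<open>Orientation\<close>

text \<open>
  The orderings \<open>(a, b, c)\<close> of the vertices that are positive for the orientation \<open>s\<close>. For these
  \<open>a \<rightarrow> b\<close> is a directed edge of the oriented boundary, and every such edge occurs once. Statements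
  about a triangle are proved for one ordering and transferred by rotation.
\<close>
fun rotations :: "int \<Rightarrow> 'e \<times> 'e \<times> 'e \<Rightarrow> ('e \<times> 'e \<times> 'e) set" where
  "rotations s (v0, v1, v2) =
     (if s = 1 then {(v0, v1, v2), (v1, v2, v0), (v2, v0, v1)}
      else {(v1, v0, v2), (v0, v2, v1), (v2, v1, v0)})"

lemma rotations_rotate: "(a, b, c) \<in> rotations s T \<Longrightarrow> (b, c, a) \<in> rotations s T"
  by (cases T) (auto split: if_splits)

lemma positive_basis_rotate:
  assumes "positive_basis s (a, b, c) x y"
  shows "positive_basis s (b, c, a) x y"
proof -
  obtain p q u v where *: "x = p *\<^sub>R (b - a) + q *\<^sub>R (c - a)" "y = u *\<^sub>R (b - a) + v *\<^sub>R (c - a)"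
    "of_int s * (p * v - q * u) > (0 :: real)"
    using assms by auto
  have "x = q *\<^sub>R (c - b) + (- p - q) *\<^sub>R (a - b)" "y = v *\<^sub>R (c - b) + (- u - v) *\<^sub>R (a - b)"
    unfolding * by (simp_all add: algebra_simps)
  moreover have "q * (- u - v) - (- p - q) * v = p * v - q * u"
    by (simp add: algebra_simps)
  ultimately show ?thesis
    unfolding positive_basis.simps using *(3) by metis
qed

lemma positive_basis_swap:
  assumes "positive_basis s (a, b, c) x y"
  shows "positive_basis (- s) (b, a, c) x y"
proof -
  obtain p q u v where *: "x = p *\<^sub>R (b - a) + q *\<^sub>R (c - a)" "y = u *\<^sub>R (b - a) + v *\<^sub>R (c - a)"
    "of_int s * (p * v - q * u) > (0 :: real)"
    using assms by auto
  have "x = (- p - q) *\<^sub>R (a - b) + q *\<^sub>R (c - b)" "y = (- u - v) *\<^sub>R (a - b) + v *\<^sub>R (c - b)"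
    unfolding * by (simp_all add: algebra_simps)
  moreover have "of_int (- s) * ((- p - q) * v - q * (- u - v)) = of_int s * (p * v - q * u)"
    by (simp add: algebra_simps)
  ultimately show ?thesis
    unfolding positive_basis.simps using *(3) by metis
qed

lemma positive_basis_rotations:
  assumes "s \<in> {1, - 1}" "(a, b, c) \<in> rotations s T" "positive_basis 1 (a, b, c) x y"
  shows "positive_basis s T x y"
proof (cases T)
  case (fields v0 v1 v2)
  have rotate: "positive_basis 1 (p, q, r) x y \<longleftrightarrow> positive_basis 1 (q, r, p) x y" for p q r
    using positive_basis_rotate by blast
  show ?thesis
  proof (cases "s = 1")
    case True
    then show ?thesis
      using assms(2,3) rotate[of v0 v1 v2] rotate[of v1 v2 v0]
      by (auto simp: fields simp del: positive_basis.simps)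
  next
    case False
    then have "positive_basis 1 (v1, v0, v2) x y"
      using assms(2,3) rotate[of v1 v0 v2] rotate[of v0 v2 v1]
      by (auto simp: fields simp del: positive_basis.simps)
    then have "positive_basis (- 1) (v0, v1, v2) x y"
      by (rule positive_basis_swap)
    then show ?thesis
      using False assms(1) by (auto simp: fields simp del: positive_basis.simps)
  qed
qed

lemma positive_basis_unique:
  assumes nd: "nondegenerate v0 v1 v2"
    and "positive_basis s (v0, v1, v2) x y" "positive_basis s (v0, v1, v2) x (- y)"
  shows False
proof -
  obtain p q u v where 1: "x = p *\<^sub>R (v1 - v0) + q *\<^sub>R (v2 - v0)" "y = u *\<^sub>R (v1 - v0) + v *\<^sub>R (v2 - v0)"
    "of_int s * (p * v - q * u) > (0 :: real)"
    using assms by auto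
  obtain p' q' u' v' where 2: "x = p' *\<^sub>R (v1 - v0) + q' *\<^sub>R (v2 - v0)"
    "- y = u' *\<^sub>R (v1 - v0) + v' *\<^sub>R (v2 - v0)" "of_int s * (p' * v' - q' * u') > (0 :: real)"
    using assms by auto
  have "(p - p') *\<^sub>R (v1 - v0) + (q - q') *\<^sub>R (v2 - v0) =
      (p *\<^sub>R (v1 - v0) + q *\<^sub>R (v2 - v0)) - (p' *\<^sub>R (v1 - v0) + q' *\<^sub>R (v2 - v0))"
    by (simp add: algebra_simps)
  also have "\<dots> = 0"
    using 1(1) 2(1) by simp
  finally have pq: "p = p'" "q = q'"
    using nd unfolding nondegenerate_def by (metis right_minus_eq)+
  have "(u + u') *\<^sub>R (v1 - v0) + (v + v') *\<^sub>R (v2 - v0) =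
      (u *\<^sub>R (v1 - v0) + v *\<^sub>R (v2 - v0)) + (u' *\<^sub>R (v1 - v0) + v' *\<^sub>R (v2 - v0))"
    by (simp add: algebra_simps)
  also have "\<dots> = 0"
    unfolding 1(2)[symmetric] 2(2)[symmetric] by simp
  finally have "u + u' = 0 \<and> v + v' = 0"
    using nd unfolding nondegenerate_def by blast
  then have "u' = - u" "v' = - v"
    by auto
  then show False
    using 1(3) 2(3) by (simp add: pq algebra_simps)
qed

section \<open>Oriented level segments of a triangle\<close>

lemma nondegenerate_rotate: "nondegenerate a b c \<Longrightarrow> nondegenerate b c a"
  unfolding nondegenerate_def
proof (intro allI impI)
  fix x y :: real
  assume nd: "\<forall>x y. x *\<^sub>R (b - a) + y *\<^sub>R (c - a) = 0 \<longrightarrow> x = 0 \<and> y = 0"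
    and 0: "x *\<^sub>R (c - b) + y *\<^sub>R (a - b) = 0"
  have "(- x - y) *\<^sub>R (b - a) + x *\<^sub>R (c - a) = 0"
    using 0 by (simp add: algebra_simps)
  then show "x = 0 \<and> y = 0"
    using nd[rule_format, of "- x - y" x] by auto
qed

lemma nondegenerate_swap: "nondegenerate a b c \<Longrightarrow> nondegenerate b a c"
  unfolding nondegenerate_def
proof (intro allI impI)
  fix x y :: real
  assume nd: "\<forall>x y. x *\<^sub>R (b - a) + y *\<^sub>R (c - a) = 0 \<longrightarrow> x = 0 \<and> y = 0"
    and 0: "x *\<^sub>R (a - b) + y *\<^sub>R (c - b) = 0"
  have "(- x - y) *\<^sub>R (b - a) + y *\<^sub>R (c - a) = 0"
    using 0 by (simp add: algebra_simps)
  then show "x = 0 \<and> y = 0"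
    using nd[rule_format, of "- x - y" y] by auto
qed

lemma nondegenerate_rotations:
  assumes "nondegenerate v0 v1 v2" "(a, b, c) \<in> rotations s (v0, v1, v2)"
  shows "nondegenerate a b c"
  using assms nondegenerate_rotate[of v0 v1 v2] nondegenerate_rotate[of v1 v2 v0]
    nondegenerate_swap[of v0 v1 v2] nondegenerate_rotate[of v1 v0 v2] nondegenerate_rotate[of v0 v2 v1]
  by (auto split: if_splits)

lemma nondegenerate_distinct:
  assumes "nondegenerate a b c"
  shows "a \<noteq> b" "a \<noteq> c" "b \<noteq> c"
proof -
  show "a \<noteq> b"
    using assms[unfolded nondegenerate_def, rule_format, of 1 0] by auto
  show "a \<noteq> c"
    using assms[unfolded nondegenerate_def, rule_format, of 0 1] by auto
  show "b \<noteq> c"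
    using assms[unfolded nondegenerate_def, rule_format, of 1 "- 1"] by auto
qed

definition in_plane :: "'e::real_vector \<Rightarrow> 'e \<Rightarrow> 'e \<Rightarrow> 'e \<Rightarrow> bool" where
  "in_plane a b c x \<longleftrightarrow> (\<exists>p q. x = p *\<^sub>R (b - a) + q *\<^sub>R (c - a))"

lemma in_plane_rotate: "in_plane a b c x \<Longrightarrow> in_plane b c a x"
  unfolding in_plane_def
proof (elim exE)
  fix p q assume "x = p *\<^sub>R (b - a) + q *\<^sub>R (c - a)"
  then have "x = q *\<^sub>R (c - b) + (- p - q) *\<^sub>R (a - b)"
    by (simp add: algebra_simps)
  then show "\<exists>p q. x = p *\<^sub>R (c - b) + q *\<^sub>R (a - b)" by blast
qed

lemma in_plane_swap: "in_plane a b c x \<Longrightarrow> in_plane b a c x"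
  unfolding in_plane_def
proof (elim exE)
  fix p q assume "x = p *\<^sub>R (b - a) + q *\<^sub>R (c - a)"
  then have "x = (- p - q) *\<^sub>R (a - b) + q *\<^sub>R (c - b)"
    by (simp add: algebra_simps)
  then show "\<exists>p q. x = p *\<^sub>R (a - b) + q *\<^sub>R (c - b)" by blast
qed

lemma in_plane_rotations:
  assumes "in_plane v0 v1 v2 x" "(a, b, c) \<in> rotations s (v0, v1, v2)"
  shows "in_plane a b c x"
  using assms in_plane_rotate[of v0 v1 v2] in_plane_rotate[of v1 v2 v0]
    in_plane_swap[of v0 v1 v2] in_plane_rotate[of v1 v0 v2] in_plane_rotate[of v0 v2 v1]
  by (auto split: if_splits)

lemma in_plane_diff: "in_plane a b c x \<Longrightarrow> in_plane a b c y \<Longrightarrow> in_plane a b c (x - y)"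
  unfolding in_plane_def
proof (elim exE)
  fix p q p' q' assume xy: "x = p *\<^sub>R (b - a) + q *\<^sub>R (c - a)" "y = p' *\<^sub>R (b - a) + q' *\<^sub>R (c - a)"
  have "x - y = (p - p') *\<^sub>R (b - a) + (q - q') *\<^sub>R (c - a)"
    unfolding xy by (simp add: algebra_simps)
  then show "\<exists>p q. x - y = p *\<^sub>R (b - a) + q *\<^sub>R (c - a)" by blast
qed

lemma in_plane_eqI:
  fixes x y :: "'e::euclidean_space"
  assumes "in_plane a b c x" "in_plane a b c y"
    "x \<bullet> (b - a) = y \<bullet> (b - a)" "x \<bullet> (c - a) = y \<bullet> (c - a)"
  shows "x = y"
proof -
  obtain p q where pq: "x - y = p *\<^sub>R (b - a) + q *\<^sub>R (c - a)"
    using in_plane_diff[OF assms(1,2)] by (auto simp: in_plane_def)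
  have "(x - y) \<bullet> (x - y) = p * ((x - y) \<bullet> (b - a)) + q * ((x - y) \<bullet> (c - a))"
    by (subst (2) pq) (simp only: inner_add_right inner_scaleR_right)
  also have "\<dots> = 0"
    using assms(3,4) by (simp add: inner_diff_left)
  finally show ?thesis by simp
qed

text \<open>
  The two prescribed products are a linear system for the coefficients of \<open>n\<close> whose determinant is
  the Gram determinant \<open>D\<close> of the two edge vectors. It is solved by Cramer's rule.
\<close>
lemma exists_gradient:
  fixes a b c :: "'e::euclidean_space"
  assumes nd: "nondegenerate a b c"
  shows "\<exists>n. in_plane a b c n \<and> n \<bullet> (b - a) = p \<and> n \<bullet> (c - a) = q"
proof -
  define e f where "e = b - a" and "f = c - a"
  define D where "D = (e \<bullet> e) * (f \<bullet> f) - (e \<bullet> f)\<^sup>2"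
  have "D \<noteq> 0"
  proof
    assume "D = 0"
    let ?y = "(f \<bullet> f) *\<^sub>R e + (- (e \<bullet> f)) *\<^sub>R f"
    have "?y \<bullet> ?y = (f \<bullet> f) * D"
      by (simp add: D_def inner_add_left inner_add_right inner_commute algebra_simps power2_eq_square)
    then have "?y = 0"
      using \<open>D = 0\<close> by simp
    then have "f \<bullet> f = 0"
      using nd unfolding nondegenerate_def e_def f_def by blast
    then show False
      using nondegenerate_distinct(2)[OF nd] by (simp add: f_def)
  qed
  let ?n = "((p * (f \<bullet> f) - q * (e \<bullet> f)) / D) *\<^sub>R e + ((q * (e \<bullet> e) - p * (e \<bullet> f)) / D) *\<^sub>R f"
  have "?n \<bullet> e = (p * D) / D" "?n \<bullet> f = (q * D) / D"
    unfolding D_def inner_add_left inner_scaleR_left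
    by (simp_all add: algebra_simps power2_eq_square inner_commute[of f e] flip: add_divide_distrib diff_divide_distrib)
  then have "?n \<bullet> e = p" "?n \<bullet> f = q"
    using \<open>D \<noteq> 0\<close> by simp_all
  then show ?thesis
    unfolding in_plane_def e_def[symmetric] f_def[symmetric] by blast
qed

text \<open>
  The orientation of a level segment is determined by where it starts. If \<open>n\<close> rises along the edge
  from \<open>a\<close> to \<open>b\<close> and the direction \<open>d\<close> is orthogonal to \<open>n\<close>, then the determinant of \<open>(n, d)\<close> is a
  positive multiple of the coefficient \<open>y\<close> that measures how far \<open>d\<close> points towards \<open>c\<close>, that is, into
  the triangle.
\<close>
lemma positive_basis_of_rising_edge:
  assumes n: "in_plane a b c n" "n \<bullet> a < n \<bullet> b"
    and d: "d = x *\<^sub>R (b - a) + y *\<^sub>R (c - a)" "n \<bullet> d = 0" "0 < y"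
  shows "positive_basis 1 (a, b, c) n d"
proof -
  obtain p q where pq: "n = p *\<^sub>R (b - a) + q *\<^sub>R (c - a)"
    using n(1) by (auto simp: in_plane_def)
  define B C where "B = n \<bullet> (b - a)" and "C = n \<bullet> (c - a)"
  have B: "0 < B"
    using n(2) by (simp add: B_def inner_diff_right)
  have "x * B + y * C = 0"
    using d(2) unfolding d(1) B_def C_def by (simp only: inner_add_right inner_scaleR_right)
  moreover have "n \<bullet> n = p * B + q * C"
    unfolding B_def C_def by (subst (2) pq) (simp only: inner_add_right inner_scaleR_right)
  moreover have "B * (p * y - q * x) = y * (p * B + q * C) - q * (x * B + y * C)"
    by (simp add: algebra_simps)
  ultimately have "B * (p * y - q * x) = y * (n \<bullet> n)"
    by simp
  moreover have "0 < n \<bullet> n"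
    using n(2) by auto
  ultimately have "0 < p * y - q * x"
    using B d(3) by (metis mult_pos_pos zero_less_mult_pos)
  then show ?thesis
    unfolding positive_basis.simps using pq d(1) by (metis mult_1 of_int_1)
qed

lemma rel_interior_triangle:
  fixes a b c :: "'e::euclidean_space"
  assumes "a \<noteq> b" "a \<noteq> c" "b \<noteq> c" and uvw: "0 < u" "0 < v" "0 < w" "u + v + w = 1"
  shows "u *\<^sub>R a + v *\<^sub>R b + w *\<^sub>R c \<in> rel_interior (convex hull {a, b, c})"
proof -
  let ?f = "\<lambda>x. if x = a then u else if x = b then v else w"
  have "\<forall>x\<in>{a, b, c}. 0 < ?f x \<and> ?f x < 1" "sum ?f {a, b, c} = 1"
    "(\<Sum>x\<in>{a, b, c}. ?f x *\<^sub>R x) = u *\<^sub>R a + v *\<^sub>R b + w *\<^sub>R c"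
    using assms by (auto simp: add.assoc)
  then have "u *\<^sub>R a + v *\<^sub>R b + w *\<^sub>R c \<in>
      {y. \<exists>f. (\<forall>x\<in>{a, b, c}. 0 < f x \<and> f x < 1) \<and> sum f {a, b, c} = 1 \<and> (\<Sum>x\<in>{a, b, c}. f x *\<^sub>R x) = y}"
    by (intro CollectI exI[of _ ?f] conjI)
  then show ?thesis
    using explicit_subset_rel_interior_convex_hull[of "{a, b, c}"] by blast
qed

text \<open>
  The points of \<open>S\<close> at which an altitude takes a half-integral value. With the altitude \<open>0\<close> at
  \<open>fst S\<close> it has the value \<open>\<phi> S\<close> at \<open>snd S\<close>, and the value \<open>m + 1 / 2\<close> at one point of \<open>S\<close> for each
  integer \<open>m\<close> in the stated range, for either sign of \<open>\<phi> S\<close>.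
\<close>
definition level_points :: "('e \<times> 'e \<Rightarrow> int) \<Rightarrow> 'e::euclidean_space \<times> 'e \<Rightarrow> 'e set" where
  "level_points \<phi> S =
     (\<lambda>m::int. fst S + ((of_int m + 1 / 2) / of_int (\<phi> S)) *\<^sub>R (snd S - fst S)) `
       {min (\<phi> S) 0..<max (\<phi> S) 0}"

lemma finite_level_points: "finite (level_points \<phi> S)"
  by (simp add: level_points_def)

lemma sum_level_points:
  assumes "fst S \<noteq> snd S"
  shows "(\<Sum>x\<in>level_points \<phi> S. sgn (\<phi> S)) = \<phi> S"
proof (cases "\<phi> S = 0")
  case False
  then have "inj_on (\<lambda>m::int. fst S + ((of_int m + 1 / 2) / of_int (\<phi> S)) *\<^sub>R (snd S - fst S)) A" for A
    using assms by (auto intro!: inj_onI)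
  then have "card (level_points \<phi> S) = nat (max (\<phi> S) 0 - min (\<phi> S) 0)"
    unfolding level_points_def by (simp add: card_image)
  then show ?thesis
    by (auto simp: sgn_if)
qed (simp add: level_points_def)

lemma level_points_open_segment:
  assumes "fst S \<noteq> snd S"
  shows "level_points \<phi> S \<subseteq> open_segment (fst S) (snd S)"
proof
  fix x assume "x \<in> level_points \<phi> S"
  then obtain m :: int where m: "min (\<phi> S) 0 \<le> m" "m < max (\<phi> S) 0"
    and x: "x = fst S + ((of_int m + 1 / 2) / of_int (\<phi> S)) *\<^sub>R (snd S - fst S)"
    by (auto simp: level_points_def)
  define u :: real where "u = (of_int m + 1 / 2) / of_int (\<phi> S)"
  have "0 < u \<and> u < 1"
  proof (cases "0 < \<phi> S")
    case True
    then have "0 \<le> m" "m + 1 \<le> \<phi> S"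
      using m by auto
    then have "0 < of_int m + 1 / (2::real)" "of_int m + 1 / (2::real) < of_int (\<phi> S)"
      by linarith+
    then show ?thesis
      by (simp add: u_def)
  next
    case False
    then have "\<phi> S \<le> m" "m + 1 \<le> 0"
      using m by auto
    then have "of_int m + 1 / (2::real) < 0" "of_int (\<phi> S) < of_int m + 1 / (2::real)"
      by linarith+
    then show ?thesis
      by (simp add: u_def divide_less_eq zero_less_divide_iff)
  qed
  moreover have "x = (1 - u) *\<^sub>R fst S + u *\<^sub>R snd S"
    unfolding x u_def[symmetric] by (simp add: algebra_simps)
  ultimately show "x \<in> open_segment (fst S) (snd S)"
    using assms unfolding in_segment by blast
qed

text \<open>
  The half-integral points on the edges along which the altitude rises (\<open>\<sigma> = 1\<close>) or falls
  (\<open>\<sigma> = - 1\<close>) when the boundary of \<open>T\<close> is traversed according to the orientation \<open>s\<close>.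
\<close>
definition edge_crossings ::
  "int \<Rightarrow> ('e \<times> 'e \<Rightarrow> int) \<Rightarrow> 'e::euclidean_space \<times> 'e \<times> 'e \<Rightarrow> int \<Rightarrow> 'e set" where
  "edge_crossings s \<phi> T \<sigma> =
     (\<Union>S\<in>{S \<in> edges_of T. s * incidence S T * sgn (\<phi> S) = \<sigma>}. level_points \<phi> S)"

text \<open>
  The altitudes of \<open>T = (v0, v1, v2)\<close> for \<open>\<phi>\<close> all have the same gradient \<open>n\<close> in the plane of \<open>T\<close>. The levels are
  therefore measured by \<open>n \<bullet> x\<close>, for which the altitude \<open>0\<close> at \<open>v0\<close> becomes \<open>n \<bullet> v0\<close>.
\<close>
locale level_triangle =
  fixes v0 v1 v2 n :: "'e::euclidean_space" and \<phi> :: "'e \<times> 'e \<Rightarrow> int" and s :: int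
  assumes nondegenerate: "nondegenerate v0 v1 v2"
    and orientation: "s \<in> {1, - 1}"
    and cocycle: "\<phi> (v0, v2) = \<phi> (v0, v1) + \<phi> (v1, v2)"
    and in_plane: "in_plane v0 v1 v2 n"
    and gradient: "n \<bullet> (v1 - v0) = of_int (\<phi> (v0, v1))" "n \<bullet> (v2 - v0) = of_int (\<phi> (v0, v2))"
begin

abbreviation "T \<equiv> (v0, v1, v2)"
abbreviation "segments \<equiv> level_segments {T} (\<lambda>_. s) \<phi>"
abbreviation "crossing_points \<equiv> edge_crossings s \<phi> T"

definition half_levels :: "real set" where
  "half_levels = {n \<bullet> v0 + (of_int m + 1 / 2) | m::int. True}"

definition level_set :: "real \<Rightarrow> 'e set" where
  "level_set l = {x \<in> convex hull {v0, v1, v2}. n \<bullet> x = l}"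

lemma gradient_edge:
  assumes "(v, w) \<in> edges_of T"
  shows "n \<bullet> w - n \<bullet> v = of_int (\<phi> (v, w))"
proof -
  have "n \<bullet> v1 = n \<bullet> v0 + of_int (\<phi> (v0, v1))" "n \<bullet> v2 = n \<bullet> v0 + of_int (\<phi> (v0, v2))"
    using gradient by (simp_all add: inner_diff_right algebra_simps)
  then show ?thesis
    using assms cocycle by auto
qed

lemma vertex_level:
  assumes "x \<in> {v0, v1, v2}"
  obtains k :: int where "n \<bullet> x = n \<bullet> v0 + of_int k"
proof -
  have "\<exists>k::int. n \<bullet> x = n \<bullet> v0 + of_int k"
    using assms gradient by (auto simp: inner_diff_right algebra_simps intro: exI[of _ 0])
  then show ?thesis
    using that by blast
qed

lemma half_level_not_vertex:
  assumes "x \<in> {v0, v1, v2}" "l \<in> half_levels"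
  shows "n \<bullet> x \<noteq> l"
proof
  assume eq: "n \<bullet> x = l"
  obtain k :: int where "n \<bullet> x = n \<bullet> v0 + of_int k"
    by (rule vertex_level[OF assms(1)])
  moreover obtain m :: int where "l = n \<bullet> v0 + (of_int m + 1 / 2)"
    using assms(2) by (auto simp: half_levels_def)
  ultimately have "of_int (2 * k) = (of_int (2 * m + 1) :: real)"
    using eq by simp
  then have "2 * k = 2 * m + 1"
    by (simp only: of_int_eq_iff)
  then show False
    by presburger
qed

lemma altitude_eq:
  assumes "altitude \<phi> T \<psi>" "x \<in> convex hull {v0, v1, v2}"
  shows "\<psi> x = \<psi> v0 + n \<bullet> (x - v0)"
proof -
  let ?H = "convex hull {v0, v1, v2}"
  obtain u v w where uvw: "0 \<le> u" "0 \<le> v" "0 \<le> w" "u + v + w = 1"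
    and x: "x = u *\<^sub>R v0 + v *\<^sub>R v1 + w *\<^sub>R v2"
    using assms(2) by (auto simp: convex_hull_3)
  have aff: "\<psi> ((1 - t) *\<^sub>R y + t *\<^sub>R z) = (1 - t) * \<psi> y + t * \<psi> z"
    if "y \<in> ?H" "z \<in> ?H" "t \<in> {0..1}" for y z t
    using assms(1) that by (auto simp: affine_on_convex_def)
  have v: "v0 \<in> ?H" "v1 \<in> ?H" "v2 \<in> ?H"
    by (auto intro: hull_inc)
  have "\<psi> x = u * \<psi> v0 + v * \<psi> v1 + w * \<psi> v2"
  proof (cases "v + w = 0")
    case True
    then have "v = 0" "w = 0" "u = 1"
      using uvw by auto
    then show ?thesis
      by (simp add: x)
  next
    case False
    define t where "t = w / (v + w)"
    have t: "t \<in> {0..1}" "(v + w) * (1 - t) = v" "(v + w) * t = w"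
      using uvw False by (auto simp: t_def field_simps)
    let ?y = "(1 - t) *\<^sub>R v1 + t *\<^sub>R v2"
    have "?y \<in> ?H"
      using convexD_alt[OF convex_convex_hull v(2,3)] t(1) by auto
    moreover have "x = (1 - (v + w)) *\<^sub>R v0 + (v + w) *\<^sub>R ?y"
    proof -
      have "(v + w) *\<^sub>R ?y = v *\<^sub>R v1 + w *\<^sub>R v2"
        by (simp add: scaleR_add_right t)
      moreover have "1 - (v + w) = u"
        using uvw by simp
      ultimately show ?thesis
        by (simp add: x)
    qed
    ultimately have "\<psi> x = (1 - (v + w)) * \<psi> v0 + (v + w) * \<psi> ?y"
      using aff[of v0 ?y "v + w"] v uvw by auto
    also have "\<psi> ?y = (1 - t) * \<psi> v1 + t * \<psi> v2"
      using aff v t by blast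
    also have "(v + w) * \<dots> = ((v + w) * (1 - t)) * \<psi> v1 + ((v + w) * t) * \<psi> v2"
      by (simp only: distrib_left mult.assoc)
    also have "1 - (v + w) = u"
      using uvw by simp
    finally show ?thesis
      unfolding t by simp
  qed
  moreover have "\<psi> v1 = \<psi> v0 + n \<bullet> (v1 - v0)" "\<psi> v2 = \<psi> v0 + n \<bullet> (v2 - v0)"
    using assms(1) by (auto simp: gradient diff_eq_eq)
  moreover have "x - v0 = v *\<^sub>R (v1 - v0) + w *\<^sub>R (v2 - v0)"
  proof -
    have u: "u = 1 - v - w"
      using uvw by simp
    show ?thesis
      unfolding x u by (simp add: algebra_simps)
  qed
  then have "n \<bullet> (x - v0) = v * (n \<bullet> (v1 - v0)) + w * (n \<bullet> (v2 - v0))"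
    by (simp only: inner_add_right inner_scaleR_right)
  ultimately have "\<psi> x = (u + v + w) * \<psi> v0 + n \<bullet> (x - v0)"
    by (simp only: distrib_left distrib_right)
  then show ?thesis
    by (simp add: uvw)
qed

lemma altitude_gradient: "altitude \<phi> T (\<lambda>x. n \<bullet> (x - v0))"
proof -
  have "n \<bullet> (w - v0) - n \<bullet> (v - v0) = of_int (\<phi> (v, w))" if "(v, w) \<in> edges_of T" for v w
    using gradient_edge[OF that] by (simp add: inner_diff_right)
  moreover have "affine_on_convex (convex hull {v0, v1, v2}) (\<lambda>x. n \<bullet> (x - v0))"
    by (simp add: affine_on_convex_def inner_diff_right inner_add_right algebra_simps)
  moreover have "(\<lambda>x. n \<bullet> (x - v0)) ` {v0, v1, v2} \<subseteq> \<int>"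
    using gradient by auto
  ultimately show ?thesis
    unfolding altitude.simps by blast
qed

text \<open>
  Replaces the altitude and its gradient, which are quantified in the definition of the level
  segments, by the fixed vector \<open>n\<close>.
\<close>
lemma segments_iff:
  "(p, q) \<in> segments \<longleftrightarrow>
     (\<exists>l\<in>half_levels. closed_segment p q = level_set l \<and> positive_basis s T n (q - p))"
proof
  assume "(p, q) \<in> segments"
  then obtain \<psi> n' and m :: int where \<psi>: "altitude \<phi> T \<psi>"
    and seg: "closed_segment p q = {x \<in> convex hull {v0, v1, v2}. \<psi> x = of_int m + 1 / 2}"
    and n': "\<forall>x\<in>convex hull {v0, v1, v2}. \<forall>y\<in>convex hull {v0, v1, v2}. \<psi> y - \<psi> x = n' \<bullet> (y - x)"
    and pos: "positive_basis s T n' (q - p)"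
    unfolding level_segments_def by (auto simp del: altitude.simps positive_basis.simps)
  have v: "v0 \<in> convex hull {v0, v1, v2}" "v1 \<in> convex hull {v0, v1, v2}" "v2 \<in> convex hull {v0, v1, v2}"
    by (auto intro: hull_inc)
  have "n' = n"
  proof (rule in_plane_eqI)
    show "in_plane v0 v1 v2 n'"
      using pos by (auto simp: in_plane_def)
    show "n' \<bullet> (v1 - v0) = n \<bullet> (v1 - v0)" "n' \<bullet> (v2 - v0) = n \<bullet> (v2 - v0)"
      using n' v altitude_eq[OF \<psi>] by (metis add_diff_cancel_left')+
  qed (rule in_plane)
  moreover obtain k :: int where "\<psi> v0 = of_int k"
    using \<psi> by (auto elim: Ints_cases)
  then have "closed_segment p q = level_set (n \<bullet> v0 + (of_int (m - k) + 1 / 2))"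
    unfolding seg level_set_def using altitude_eq[OF \<psi>] by (auto simp: inner_diff_right)
  ultimately show "\<exists>l\<in>half_levels. closed_segment p q = level_set l \<and> positive_basis s T n (q - p)"
    using pos unfolding half_levels_def by blast
next
  assume "\<exists>l\<in>half_levels. closed_segment p q = level_set l \<and> positive_basis s T n (q - p)"
  then obtain m :: int where m: "closed_segment p q = level_set (n \<bullet> v0 + (of_int m + 1 / 2))"
    and pos: "positive_basis s T n (q - p)"
    unfolding half_levels_def by blast
  have "closed_segment p q = {x \<in> triangle_hull T. n \<bullet> (x - v0) = of_int m + 1 / 2}"
    unfolding m level_set_def by (auto simp: inner_diff_right)
  moreover have "\<forall>x\<in>triangle_hull T. \<forall>y\<in>triangle_hull T. n \<bullet> (y - v0) - n \<bullet> (x - v0) = n \<bullet> (y - x)"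
    by (simp add: inner_diff_right)
  ultimately show "(p, q) \<in> segments"
    unfolding level_segments_def using pos altitude_gradient by blast
qed

text \<open>
  Where the level \<open>l\<close> leaves the triangle if \<open>n\<close> rises through \<open>l\<close> on the edge from \<open>a\<close> to \<open>b\<close>. The
  vertex alone on its side of the level is \<open>b\<close> in the first case and \<open>a\<close> in the second.
\<close>
definition level_end :: "real \<Rightarrow> 'e \<Rightarrow> 'e \<Rightarrow> 'e \<Rightarrow> 'e" where
  "level_end l a b c = (if n \<bullet> c < l then cross n l b c else cross n l c a)"

lemma rotations_vertices: "(a, b, c) \<in> rotations s T \<Longrightarrow> {a, b, c} = {v0, v1, v2}"
  by (auto split: if_splits)

text \<open>
  An upward crossing of a half-integral level on the oriented boundary starts a level segment: seen
  from a point of the edge from \<open>a\<close> to \<open>b\<close>, the rest of the level set lies on the side of \<open>c\<close>, so this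
  is the positive direction.
\<close>
lemma rising_edge_segment:
  assumes abc: "(a, b, c) \<in> rotations s T" and l: "l \<in> half_levels" and up: "n \<bullet> a < l" "l < n \<bullet> b"
  shows "(cross n l a b, level_end l a b c) \<in> segments" (is ?thesis1)
    and "closed_segment (cross n l a b) (level_end l a b c) = level_set l" (is ?thesis2)
proof -
  have hull: "{v0, v1, v2} = {a, b, c}"
    using rotations_vertices[OF abc] by simp
  have c: "n \<bullet> c \<noteq> l"
    using half_level_not_vertex[OF _ l] hull by blast
  show eq: ?thesis2
  proof (cases "n \<bullet> c < l")
    case True
    then show ?thesis
      using level_set_lone_vertex[of n b l a c] up cross_commute[of n a b l]
      by (simp add: level_end_def level_set_def hull insert_commute)
  next
    case False
    then show ?thesis
      using level_set_lone_vertex[of n a l b c] up c cross_commute[of n a c l]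
      by (simp add: level_end_def level_set_def hull insert_commute)
  qed
  have "n \<bullet> cross n l a b = l"
    using up by (intro inner_cross) auto
  moreover have "n \<bullet> level_end l a b c = l"
    using up c by (auto simp: level_end_def intro!: inner_cross)
  ultimately have d0: "n \<bullet> (level_end l a b c - cross n l a b) = 0"
    by (simp add: inner_diff_right)
  obtain \<sigma> where \<sigma>: "cross n l a b = a + \<sigma> *\<^sub>R (b - a)"
    using cross_parameter[of n a l b] up by blast
  have "\<exists>x y. level_end l a b c - cross n l a b = x *\<^sub>R (b - a) + y *\<^sub>R (c - a) \<and> 0 < y"
  proof (cases "n \<bullet> c < l")
    case True
    then obtain t where "0 < t" "cross n l b c = b + t *\<^sub>R (c - b)"
      using cross_parameter[of n b l c] up by blast
    moreover from this have "level_end l a b c - cross n l a b = (1 - \<sigma> - t) *\<^sub>R (b - a) + t *\<^sub>R (c - a)"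
      using True by (simp add: level_end_def \<sigma> algebra_simps)
    ultimately show ?thesis by blast
  next
    case False
    then obtain t where t: "t < 1" "cross n l c a = c + t *\<^sub>R (a - c)"
      using cross_parameter[of n c l a] up c by fastforce
    then have "level_end l a b c - cross n l a b = (- \<sigma>) *\<^sub>R (b - a) + (1 - t) *\<^sub>R (c - a)"
      using False by (simp add: level_end_def \<sigma> algebra_simps)
    then show ?thesis
      using t(1) by (metis diff_gt_0_iff_gt)
  qed
  then obtain x y where d: "level_end l a b c - cross n l a b = x *\<^sub>R (b - a) + y *\<^sub>R (c - a)" "0 < y"
    by blast
  have "positive_basis 1 (a, b, c) n (level_end l a b c - cross n l a b)"
    using up by (intro positive_basis_of_rising_edge[OF in_plane_rotations[OF in_plane abc] _ d(1) d0 d(2)]) auto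
  then show ?thesis1
    unfolding segments_iff using eq l positive_basis_rotations[OF orientation abc] by blast
qed

text \<open>
  Conversely, every level segment starts at an upward crossing. A level that separates the
  vertices is crossed upwards by some edge of the oriented boundary, and the segment constructed from
  this edge can differ from the given one only in its direction, which the orientation fixes.
\<close>
lemma segments_cases:
  assumes "(p, q) \<in> segments"
  obtains a b c l where "(a, b, c) \<in> rotations s T" "l \<in> half_levels" "n \<bullet> a < l" "l < n \<bullet> b"
    "p = cross n l a b" "q = level_end l a b c" "closed_segment p q = level_set l"
proof -
  obtain l where l: "l \<in> half_levels" and seg: "closed_segment p q = level_set l"
    and pos: "positive_basis s T n (q - p)"
    using assms unfolding segments_iff by blast
  have side: "n \<bullet> x < l \<or> l < n \<bullet> x" if "x \<in> {v0, v1, v2}" for x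
    using half_level_not_vertex[OF that l] by linarith
  \<comment> \<open>The level set is not empty, so the level separates the vertices.\<close>
  have "n \<bullet> v0 < l \<or> n \<bullet> v1 < l \<or> n \<bullet> v2 < l"
  proof (rule ccontr)
    assume "\<not> ?thesis"
    then have "{v0, v1, v2} \<subseteq> {x. n \<bullet> x > l}"
      using side by blast
    then have "convex hull {v0, v1, v2} \<subseteq> {x. n \<bullet> x > l}"
      by (intro hull_minimal convex_halfspace_gt)
    then have "level_set l = {}"
      by (auto simp: level_set_def)
    then show False
      using seg by simp
  qed
  moreover have "l < n \<bullet> v0 \<or> l < n \<bullet> v1 \<or> l < n \<bullet> v2"
  proof (rule ccontr)
    assume "\<not> ?thesis"
    then have "{v0, v1, v2} \<subseteq> {x. n \<bullet> x < l}"
      using side by blast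
    then have "convex hull {v0, v1, v2} \<subseteq> {x. n \<bullet> x < l}"
      by (intro hull_minimal convex_halfspace_lt)
    then have "level_set l = {}"
      by (auto simp: level_set_def)
    then show False
      using seg by simp
  qed
  ultimately have *: "(n \<bullet> v0 < l \<and> l < n \<bullet> v1 \<or> n \<bullet> v1 < l \<and> l < n \<bullet> v2 \<or> n \<bullet> v2 < l \<and> l < n \<bullet> v0) \<and>
      (n \<bullet> v1 < l \<and> l < n \<bullet> v0 \<or> n \<bullet> v0 < l \<and> l < n \<bullet> v2 \<or> n \<bullet> v2 < l \<and> l < n \<bullet> v1)"
    using side[of v0] side[of v1] side[of v2] by (meson insertCI)
  have "\<exists>a b c. (a, b, c) \<in> rotations s T \<and> n \<bullet> a < l \<and> l < n \<bullet> b"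
  proof (cases "s = 1")
    case True
    then have "(v0, v1, v2) \<in> rotations s T \<and> (v1, v2, v0) \<in> rotations s T \<and> (v2, v0, v1) \<in> rotations s T"
      by simp
    with * show ?thesis by (elim conjE disjE) (intro exI conjI; assumption)+
  next
    case False
    then have "(v1, v0, v2) \<in> rotations s T \<and> (v0, v2, v1) \<in> rotations s T \<and> (v2, v1, v0) \<in> rotations s T"
      by simp
    with * show ?thesis by (elim conjE disjE) (intro exI conjI; assumption)+
  qed
  then obtain a b c where abc: "(a, b, c) \<in> rotations s T" and up: "n \<bullet> a < l" "l < n \<bullet> b"
    by blast
  note rise = rising_edge_segment[OF abc l up]
  have "closed_segment p q = closed_segment (cross n l a b) (level_end l a b c)"
    using rise(2) seg by (rule trans[OF _ sym, rotated])
  then have "{p, q} = {cross n l a b, level_end l a b c}"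
    by (simp only: closed_segment_eq)
  moreover have "\<not> (p = level_end l a b c \<and> q = cross n l a b)"
  proof
    assume *: "p = level_end l a b c \<and> q = cross n l a b"
    have "positive_basis s T n (level_end l a b c - cross n l a b)"
      using rise(1) unfolding segments_iff by blast
    then have "positive_basis s T n (- (q - p))"
      using * by simp
    then show False
      using positive_basis_unique[OF nondegenerate pos] by blast
  qed
  ultimately have "p = cross n l a b" "q = level_end l a b c"
    unfolding doubleton_eq_iff by blast+
  then show ?thesis
    using that[OF abc l up] seg by simp
qed

lemma segments_meet:
  assumes pq: "(p, q) \<in> segments" "(p', q') \<in> segments"
    and x: "x \<in> closed_segment p q" "x \<in> closed_segment p' q'"
  shows "p = p' \<and> q = q'"
proof -
  obtain l where l: "closed_segment p q = level_set l" "positive_basis s T n (q - p)"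
    using pq(1) unfolding segments_iff by blast
  obtain l' where l': "closed_segment p' q' = level_set l'" "positive_basis s T n (q' - p')"
    using pq(2) unfolding segments_iff by blast
  have "l = l'"
    using x unfolding l l' by (simp add: level_set_def)
  then have "{p, q} = {p', q'}"
    using l(1) l'(1) closed_segment_eq by metis
  moreover have "\<not> (p = q' \<and> q = p')"
  proof
    assume "p = q' \<and> q = p'"
    then have "positive_basis s T n (- (q - p))"
      using l'(2) by (simp del: positive_basis.simps)
    then show False
      using positive_basis_unique[OF nondegenerate l(2)] by blast
  qed
  ultimately show ?thesis
    unfolding doubleton_eq_iff by blast
qed

lemma segments_nontrivial: "(p, q) \<in> segments \<Longrightarrow> p \<noteq> q"
  using positive_basis_unique[OF nondegenerate, of s n 0] unfolding segments_iff by force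

lemma boundary_edge_of_rotation:
  assumes "(a, b, c) \<in> rotations s T"
  shows "(a, b) \<in> edges_of T \<and> s * incidence (a, b) T = 1 \<or>
         (b, a) \<in> edges_of T \<and> s * incidence (b, a) T = - 1"
  using assms orientation nondegenerate_distinct[OF nondegenerate] by (auto split: if_splits)

lemma rotation_of_boundary_edge:
  assumes "(v, w) \<in> edges_of T"
  shows "s * incidence (v, w) T = 1 \<and> (\<exists>c. (v, w, c) \<in> rotations s T) \<or>
         s * incidence (v, w) T = - 1 \<and> (\<exists>c. (w, v, c) \<in> rotations s T)"
  using assms orientation nondegenerate_distinct[OF nondegenerate] by auto

lemma level_points_iff:
  assumes e: "(v, w) \<in> edges_of T"
  shows "x \<in> level_points \<phi> (v, w) \<longleftrightarrow>
    (\<exists>l\<in>half_levels. (n \<bullet> v < l \<and> l < n \<bullet> w \<or> n \<bullet> w < l \<and> l < n \<bullet> v) \<and> x = cross n l v w)"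
    (is "?L \<longleftrightarrow> ?R")
proof -
  have k: "n \<bullet> w - n \<bullet> v = of_int (\<phi> (v, w))"
    by (rule gradient_edge[OF e])
  have "v \<in> {v0, v1, v2}"
    using e by auto
  then obtain j :: int where j: "n \<bullet> v = n \<bullet> v0 + of_int j"
    by (rule vertex_level)
  have half: "l \<in> half_levels \<longleftrightarrow> (\<exists>m::int. l = n \<bullet> v + (of_int m + 1 / 2))" for l
  proof
    assume "l \<in> half_levels"
    then obtain m :: int where "l = n \<bullet> v0 + (of_int m + 1 / 2)"
      unfolding half_levels_def by blast
    then have "l = n \<bullet> v + (of_int (m - j) + 1 / 2)"
      by (simp add: j)
    then show "\<exists>m::int. l = n \<bullet> v + (of_int m + 1 / 2)" by blast
  next
    assume "\<exists>m::int. l = n \<bullet> v + (of_int m + 1 / 2)"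
    then obtain m :: int where "l = n \<bullet> v + (of_int m + 1 / 2)" by blast
    then have "l = n \<bullet> v0 + (of_int (j + m) + 1 / 2)"
      by (simp add: j)
    then show "l \<in> half_levels"
      unfolding half_levels_def by blast
  qed
  have range: "m \<in> {min (\<phi> (v, w)) 0..<max (\<phi> (v, w)) 0} \<longleftrightarrow>
      n \<bullet> v < n \<bullet> v + (of_int m + 1 / 2) \<and> n \<bullet> v + (of_int m + 1 / 2) < n \<bullet> w \<or>
      n \<bullet> w < n \<bullet> v + (of_int m + 1 / 2) \<and> n \<bullet> v + (of_int m + 1 / 2) < n \<bullet> v" for m :: int
  proof -
    have w: "n \<bullet> w = n \<bullet> v + of_int (\<phi> (v, w))"
      using k by simp
    have 1: "0 < of_int m + 1 / (2::real) \<longleftrightarrow> 0 \<le> m"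
      by linarith
    have 2: "of_int m + 1 / (2::real) < of_int (\<phi> (v, w)) \<longleftrightarrow> m < \<phi> (v, w)"
      by linarith
    have 3: "of_int (\<phi> (v, w)) < of_int m + 1 / (2::real) \<longleftrightarrow> \<phi> (v, w) \<le> m"
      by linarith
    have 4: "of_int m + 1 / (2::real) < 0 \<longleftrightarrow> m < 0"
      by linarith
    show ?thesis
      unfolding w by (auto simp only: add_less_cancel_left less_add_same_cancel1 add_less_same_cancel1
          1 2 3 4 atLeastLessThan_iff min_def max_def split: if_splits)
  qed
  have cross: "v + ((of_int m + 1 / 2) / of_int (\<phi> (v, w))) *\<^sub>R (w - v) =
      cross n (n \<bullet> v + (of_int m + 1 / 2)) v w" for m :: int
    by (simp add: cross_def k)
  show ?thesis
    unfolding level_points_def fst_conv snd_conv image_iff cross Bex_def range half by blast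
qed

lemma level_point_sign:
  assumes e: "(v, w) \<in> edges_of T" and "n \<bullet> v < l" "l < n \<bullet> w"
  shows "sgn (\<phi> (v, w)) = 1"
proof -
  have "0 < (of_int (\<phi> (v, w)) :: real)"
    using gradient_edge[OF e] assms(2,3) by linarith
  then show ?thesis by simp
qed

lemma level_point_sign':
  assumes e: "(v, w) \<in> edges_of T" and "n \<bullet> w < l" "l < n \<bullet> v"
  shows "sgn (\<phi> (v, w)) = - 1"
proof -
  have "(of_int (\<phi> (v, w)) :: real) < 0"
    using gradient_edge[OF e] assms(2,3) by linarith
  then show ?thesis by simp
qed

text \<open>
  Translates from increasing edges with incidence numbers to directed edges of the oriented boundary.
\<close>
lemma crossing_points_iff:
  assumes \<sigma>: "\<sigma> = 1 \<or> \<sigma> = - 1"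
  shows "x \<in> crossing_points \<sigma> \<longleftrightarrow>
    (\<exists>a b c l. (a, b, c) \<in> rotations s T \<and> l \<in> half_levels \<and> x = cross n l a b \<and>
       (if \<sigma> = 1 then n \<bullet> a < l \<and> l < n \<bullet> b else n \<bullet> b < l \<and> l < n \<bullet> a))" (is "?L \<longleftrightarrow> ?R")
proof
  assume ?L
  then obtain v w where e: "(v, w) \<in> edges_of T" and sg: "s * incidence (v, w) T * sgn (\<phi> (v, w)) = \<sigma>"
    and "x \<in> level_points \<phi> (v, w)"
    unfolding edge_crossings_def by auto
  then obtain l where l: "l \<in> half_levels" and x: "x = cross n l v w"
    and between: "n \<bullet> v < l \<and> l < n \<bullet> w \<or> n \<bullet> w < l \<and> l < n \<bullet> v"
    unfolding level_points_iff[OF e] by blast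
  have x': "x = cross n l w v"
    unfolding x by (rule cross_commute) (use between in auto)
  show ?R
    using rotation_of_boundary_edge[OF e]
  proof (elim disjE conjE exE)
    fix c assume i: "s * incidence (v, w) T = 1" and c: "(v, w, c) \<in> rotations s T"
    have "if \<sigma> = 1 then n \<bullet> v < l \<and> l < n \<bullet> w else n \<bullet> w < l \<and> l < n \<bullet> v"
      using sg between level_point_sign[OF e, of l] level_point_sign'[OF e, of l] \<sigma> unfolding i by auto
    then show ?R
      using c l x by blast
  next
    fix c assume i: "s * incidence (v, w) T = - 1" and c: "(w, v, c) \<in> rotations s T"
    have "if \<sigma> = 1 then n \<bullet> w < l \<and> l < n \<bullet> v else n \<bullet> v < l \<and> l < n \<bullet> w"
      using sg between level_point_sign[OF e, of l] level_point_sign'[OF e, of l] \<sigma> unfolding i by auto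
    then show ?R
      using c l x' by blast
  qed
next
  assume ?R
  then obtain a b c l where abc: "(a, b, c) \<in> rotations s T" and l: "l \<in> half_levels"
    and x: "x = cross n l a b"
    and between: "if \<sigma> = 1 then n \<bullet> a < l \<and> l < n \<bullet> b else n \<bullet> b < l \<and> l < n \<bullet> a"
    by blast
  have x': "x = cross n l b a"
    unfolding x by (rule cross_commute) (use between in \<open>auto split: if_splits\<close>)
  show ?L
    using boundary_edge_of_rotation[OF abc]
  proof (elim disjE conjE)
    assume e: "(a, b) \<in> edges_of T" and i: "s * incidence (a, b) T = 1"
    have "s * incidence (a, b) T * sgn (\<phi> (a, b)) = \<sigma>"
      using between level_point_sign[OF e, of l] level_point_sign'[OF e, of l] \<sigma> unfolding i by auto
    moreover have "x \<in> level_points \<phi> (a, b)"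
      unfolding level_points_iff[OF e] using l x between by (auto split: if_splits)
    ultimately show ?L
      unfolding edge_crossings_def using e by blast
  next
    assume e: "(b, a) \<in> edges_of T" and i: "s * incidence (b, a) T = - 1"
    have "s * incidence (b, a) T * sgn (\<phi> (b, a)) = \<sigma>"
      using between level_point_sign[OF e, of l] level_point_sign'[OF e, of l] \<sigma> unfolding i by auto
    moreover have "x \<in> level_points \<phi> (b, a)"
      unfolding level_points_iff[OF e] using l x' between by (auto split: if_splits)
    ultimately show ?L
      unfolding edge_crossings_def using e by blast
  qed
qed

text \<open>
  A level segment is determined by its start point, since this point lies on a single level set, on
  which the orientation singles out one direction.
\<close>
theorem bij_betw_starts: "bij_betw fst segments (crossing_points 1)"
  unfolding bij_betw_def
proof
  show "inj_on fst segments"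
  proof (rule inj_onI)
    fix y z assume yz: "y \<in> segments" "z \<in> segments" "fst y = fst z"
    obtain p q p' q' where "y = (p, q)" "z = (p', q')"
      by (cases y, cases z)
    with yz show "y = z"
      using segments_meet[of p q p' q' "fst y"] by simp
  qed
  show "fst ` segments = crossing_points 1"
  proof (intro equalityI subsetI)
    fix p assume "p \<in> fst ` segments"
    then obtain q where "(p, q) \<in> segments" by auto
    then have "\<exists>a b c l. (a, b, c) \<in> rotations s T \<and> l \<in> half_levels \<and> p = cross n l a b \<and> n \<bullet> a < l \<and> l < n \<bullet> b"
      by (rule segments_cases) blast
    then show "p \<in> crossing_points 1"
      by (simp add: crossing_points_iff del: rotations.simps)
  next
    fix p assume "p \<in> crossing_points 1"
    then have "\<exists>a b c l. (a, b, c) \<in> rotations s T \<and> l \<in> half_levels \<and> p = cross n l a b \<and> n \<bullet> a < l \<and> l < n \<bullet> b"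
      by (simp add: crossing_points_iff del: rotations.simps)
    then have "\<exists>q. (p, q) \<in> segments"
      using rising_edge_segment(1) by blast
    then show "p \<in> fst ` segments"
      by force
  qed
qed

text \<open>
  If the level \<open>l\<close> falls along the edge from \<open>a\<close> to \<open>b\<close>, it rises along the one of the other two
  edges of the oriented boundary whose end points it separates. The level segment that starts there
  ends on the edge from \<open>a\<close> to \<open>b\<close>.
\<close>
theorem bij_betw_ends: "bij_betw snd segments (crossing_points (- 1))"
  unfolding bij_betw_def
proof
  show "inj_on snd segments"
  proof (rule inj_onI)
    fix y z assume yz: "y \<in> segments" "z \<in> segments" "snd y = snd z"
    obtain p q p' q' where "y = (p, q)" "z = (p', q')"
      by (cases y, cases z)
    with yz show "y = z"
      using segments_meet[of p q p' q' "snd y"] by simp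
  qed
  have vertex: "c \<in> {v0, v1, v2}" if "(a, b, c) \<in> rotations s T" for a b c
    using rotations_vertices[OF that] by blast
  show "snd ` segments = crossing_points (- 1)"
  proof (intro equalityI subsetI)
    fix q assume "q \<in> snd ` segments"
    then obtain p where "(p, q) \<in> segments" by auto
    then obtain a b c l where abc: "(a, b, c) \<in> rotations s T" and l: "l \<in> half_levels"
      and up: "n \<bullet> a < l" "l < n \<bullet> b" and q: "q = level_end l a b c"
      by (rule segments_cases)
    have bca: "(b, c, a) \<in> rotations s T"
      by (rule rotations_rotate[OF abc])
    have cab: "(c, a, b) \<in> rotations s T"
      by (rule rotations_rotate[OF bca])
    have "n \<bullet> c \<noteq> l"
      using half_level_not_vertex[OF vertex[OF abc] l] .
    then have "n \<bullet> c < l \<or> l < n \<bullet> c"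
      by linarith
    then show "q \<in> crossing_points (- 1)"
    proof
      assume "n \<bullet> c < l"
      then have "q = cross n l b c \<and> n \<bullet> c < l \<and> l < n \<bullet> b"
        using up q by (simp add: level_end_def)
      then have "\<exists>a b c l. (a, b, c) \<in> rotations s T \<and> l \<in> half_levels \<and> q = cross n l a b \<and> n \<bullet> b < l \<and> l < n \<bullet> a"
        using bca l by blast
      then show ?thesis
        by (simp add: crossing_points_iff del: rotations.simps)
    next
      assume "l < n \<bullet> c"
      then have "q = cross n l c a \<and> n \<bullet> a < l \<and> l < n \<bullet> c"
        using up q by (simp add: level_end_def)
      then have "\<exists>a b c l. (a, b, c) \<in> rotations s T \<and> l \<in> half_levels \<and> q = cross n l a b \<and> n \<bullet> b < l \<and> l < n \<bullet> a"
        using cab l by blast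
      then show ?thesis
        by (simp add: crossing_points_iff del: rotations.simps)
    qed
  next
    fix q assume "q \<in> crossing_points (- 1)"
    then have "\<exists>a b c l. (a, b, c) \<in> rotations s T \<and> l \<in> half_levels \<and> q = cross n l a b \<and> n \<bullet> b < l \<and> l < n \<bullet> a"
      by (simp add: crossing_points_iff del: rotations.simps)
    then obtain a b c l where abc: "(a, b, c) \<in> rotations s T" and l: "l \<in> half_levels"
      and down: "n \<bullet> b < l" "l < n \<bullet> a" and q: "q = cross n l a b"
      by blast
    have bca: "(b, c, a) \<in> rotations s T"
      by (rule rotations_rotate[OF abc])
    have cab: "(c, a, b) \<in> rotations s T"
      by (rule rotations_rotate[OF bca])
    have "n \<bullet> c \<noteq> l"
      using half_level_not_vertex[OF vertex[OF abc] l] .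
    then have "n \<bullet> c < l \<or> l < n \<bullet> c"
      by linarith
    then have "\<exists>p. (p, q) \<in> segments"
    proof
      assume c: "n \<bullet> c < l"
      have "level_end l c a b = q"
        using down q by (simp add: level_end_def)
      then show ?thesis
        using rising_edge_segment(1)[OF cab l c down(2)] by blast
    next
      assume c: "l < n \<bullet> c"
      have "level_end l b c a = q"
        using down q by (simp add: level_end_def)
      then show ?thesis
        using rising_edge_segment(1)[OF bca l down(1) c] by blast
    qed
    then show "q \<in> snd ` segments"
      by force
  qed
qed

lemma segments_interior:
  assumes "(p, q) \<in> segments" "x \<in> closed_segment p q" "x \<noteq> p" "x \<noteq> q"
  shows "x \<in> rel_interior (convex hull {v0, v1, v2})"
  using assms(1)
proof (rule segments_cases)
  fix a b c l
  assume abc: "(a, b, c) \<in> rotations s T" and l: "l \<in> half_levels"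
    and up: "n \<bullet> a < l" "l < n \<bullet> b" and p: "p = cross n l a b" and q: "q = level_end l a b c"
  have hull: "{v0, v1, v2} = {a, b, c}"
    using rotations_vertices[OF abc] by simp
  have dist: "a \<noteq> b" "a \<noteq> c" "b \<noteq> c"
    using nondegenerate_distinct[OF nondegenerate_rotations[OF nondegenerate abc]] .
  have c: "n \<bullet> c \<noteq> l"
    using half_level_not_vertex[OF _ l] hull by blast
  have x: "x \<in> open_segment p q"
    using assms by (simp add: open_segment_def)
  show ?thesis
  proof (cases "n \<bullet> c < l")
    case True
    then have "x \<in> open_segment (cross n l b a) (cross n l b c)"
      using x up cross_commute[of n a b l] by (simp add: p q level_end_def)
    then show ?thesis
      using open_level_segment_interior[of n b l a c x] up True rel_interior_triangle[of b a c] dist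
      unfolding hull by (auto simp: insert_commute)
  next
    case False
    then have "x \<in> open_segment (cross n l a b) (cross n l a c)"
      using x up c cross_commute[of n a c l] by (simp add: p q level_end_def)
    then show ?thesis
      using open_level_segment_interior[of n a l b c x] up False c rel_interior_triangle[of a b c] dist
      unfolding hull by auto
  qed
qed

end

section \<open>Triangles of a simplicial complex\<close>

text \<open>
  The points of \<open>A\<close> are the vertices of the simplex: the vertices are extreme points and hence belong
  to \<open>A\<close>, and there is no room for others.
\<close>
lemma simplex_vertices_eq:
  fixes A :: "'e::euclidean_space set"
  assumes "int (card A) \<le> n + 1" "finite A" "n simplex (convex hull A)"
  shows "\<not> affine_dependent A" "int (card A) = n + 1"
proof -
  obtain C where C: "\<not> affine_dependent C" "int (card C) = n + 1" "convex hull A = convex hull C"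
    using assms(3) by (auto simp: simplex_def)
  have "C \<subseteq> A"
  proof
    fix x assume "x \<in> C"
    then have "x extreme_point_of (convex hull A)"
      using C by (simp add: extreme_point_of_convex_hull_affine_independent)
    then show "x \<in> A"
      by (rule extreme_point_of_convex_hull)
  qed
  then have "C = A"
    using assms(1,2) C(2) by (intro card_seteq) auto
  then show "\<not> affine_dependent A" "int (card A) = n + 1"
    using C by simp_all
qed

lemma nondegenerate_if_affine_independent:
  fixes a b c :: "'e::euclidean_space"
  assumes "\<not> affine_dependent {a, b, c}" "a \<noteq> b" "a \<noteq> c" "b \<noteq> c"
  shows "nondegenerate a b c"
  unfolding nondegenerate_def
proof (intro allI impI)
  fix x y :: real
  assume 0: "x *\<^sub>R (b - a) + y *\<^sub>R (c - a) = 0"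
  let ?U = "\<lambda>z. if z = a then - x - y else if z = b then x else y"
  have "sum ?U {a, b, c} = 0" "(\<Sum>z\<in>{a, b, c}. ?U z *\<^sub>R z) = 0"
    using assms(2-4) 0 by (auto simp: algebra_simps)
  then have "\<forall>z\<in>{a, b, c}. ?U z = 0"
    using assms(1) affine_dependent_explicit_finite[of "{a, b, c}"] by blast
  then show "x = 0 \<and> y = 0"
    using assms(2-4) by auto
qed

lemma affine_independent_hull_eq:
  fixes A B :: "'e::euclidean_space set"
  assumes "\<not> affine_dependent A" "\<not> affine_dependent B" "convex hull A = convex hull B"
  shows "A = B"
  using extreme_point_of_convex_hull_affine_independent[OF assms(1)]
    extreme_point_of_convex_hull_affine_independent[OF assms(2)] assms(3) by auto

text \<open>
  \<open>A \<inter> B\<close> is a face of \<open>A\<close>, and a face that meets the relative interior is everything.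
\<close>
lemma simplicial_complex_face_subset:
  fixes K :: "'e::euclidean_space set set"
  assumes K: "simplicial_complex K" and AB: "A \<in> K" "B \<in> K" and x: "x \<in> rel_interior A" "x \<in> B"
  shows "A \<subseteq> B"
proof -
  have "A \<inter> B face_of A"
    using K AB unfolding simplicial_complex_def by blast
  moreover have "A \<inter> B \<inter> rel_interior A \<noteq> {}"
    using x rel_interior_subset by blast
  ultimately have "A \<subseteq> A \<inter> B"
    by (rule subset_of_face_of[OF _ order_refl])
  then show ?thesis by blast
qed

lemma simplicial_complex_rel_interiors_disjoint:
  fixes K :: "'e::euclidean_space set set"
  assumes "simplicial_complex K" "A \<in> K" "B \<in> K" "x \<in> rel_interior A" "x \<in> rel_interior B"
  shows "A = B"
proof
  show "A \<subseteq> B"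
    using simplicial_complex_face_subset[OF assms(1-4)] assms(5) rel_interior_subset by blast
  show "B \<subseteq> A"
    using simplicial_complex_face_subset[OF assms(1,3,2,5)] assms(4) rel_interior_subset by blast
qed

locale ordered_complex =
  fixes K :: "'e::euclidean_space set set" and r :: "('e \<times> 'e) set"
  assumes complex: "simplicial_complex K"
    and order: "linear_order_on (vertices K) r"
begin

lemma trans_order: "trans r" and antisym_order: "antisym r"
  using order by (auto simp: order_on_defs)

lemma triangleD:
  assumes "(v0, v1, v2) \<in> triangles K r"
  shows "\<not> affine_dependent {v0, v1, v2}" "v0 \<noteq> v1" "v0 \<noteq> v2" "v1 \<noteq> v2"
    "(v0, v1) \<in> r" "(v0, v2) \<in> r" "(v1, v2) \<in> r" "convex hull {v0, v1, v2} \<in> K"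
proof -
  have *: "(v0, v1) \<in> r" "(v1, v2) \<in> r" "convex hull {v0, v1, v2} \<in> K" "v0 \<noteq> v1" "v1 \<noteq> v2"
    "2 simplex (convex hull {v0, v1, v2})"
    using assms by (auto simp: triangles_def)
  have "card {v0, v1, v2} \<le> 3"
    by (simp add: card_insert_if)
  then have "int (card {v0, v1, v2}) \<le> 2 + 1"
    by simp
  then show "\<not> affine_dependent {v0, v1, v2}"
    using simplex_vertices_eq(1)[OF _ _ *(6)] by blast
  show "v0 \<noteq> v2"
    using * antisymD[OF antisym_order] by blast
  show "(v0, v2) \<in> r"
    using * transD[OF trans_order] by blast
  show "v0 \<noteq> v1" "v1 \<noteq> v2" "(v0, v1) \<in> r" "(v1, v2) \<in> r" "convex hull {v0, v1, v2} \<in> K"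
    using * by blast+
qed

lemma triangle_nondegenerate: "(v0, v1, v2) \<in> triangles K r \<Longrightarrow> nondegenerate v0 v1 v2"
  using nondegenerate_if_affine_independent triangleD by blast

lemma triangle_hull_in_complex: "T \<in> triangles K r \<Longrightarrow> triangle_hull T \<in> K"
  using triangleD(8) by (cases T) auto

text \<open>The hull determines the vertices, and the order determines how they are listed.\<close>
lemma triangle_hull_inject:
  assumes T: "T \<in> triangles K r" and T': "T' \<in> triangles K r" and eq: "triangle_hull T = triangle_hull T'"
  shows "T = T'"
proof -
  obtain v0 v1 v2 where v: "T = (v0, v1, v2)"
    by (cases T)
  obtain w0 w1 w2 where w: "T' = (w0, w1, w2)"
    by (cases T')
  note a = triangleD[OF T[unfolded v]] and b = triangleD[OF T'[unfolded w]]
  have set: "{v0, v1, v2} = {w0, w1, w2}"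
    using affine_independent_hull_eq[OF a(1) b(1)] eq by (simp add: v w)
  have mutual: "x = y" if "x = y \<or> (x, y) \<in> r" "x = y \<or> (y, x) \<in> r" for x y
    using that antisymD[OF antisym_order] by blast
  have mem: "v0 \<in> {w0, w1, w2}" "w0 \<in> {v0, v1, v2}" "v2 \<in> {w0, w1, w2}" "w2 \<in> {v0, v1, v2}"
    using set by blast+
  have "w0 = v0 \<or> (w0, v0) \<in> r" "v0 = w0 \<or> (v0, w0) \<in> r"
    "w2 = v2 \<or> (v2, w2) \<in> r" "v2 = w2 \<or> (w2, v2) \<in> r"
    using mem a(5-7) b(5-7) by auto
  then have "v0 = w0" "v2 = w2"
    using mutual by metis+
  moreover have "v1 \<in> {w0, w1, w2}"
    using set by blast
  ultimately have "v0 = w0" "v2 = w2" "v1 = w1"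
    using a(2-4) by auto
  then show ?thesis
    by (simp add: v w)
qed

text \<open>
  A triangle whose interior meets another one is contained in it, hence a face of it. A proper face
  would have a smaller dimension.
\<close>
lemma triangles_meet_in_boundary:
  assumes T: "T \<in> triangles K r" and T': "T' \<in> triangles K r"
    and x: "x \<in> rel_interior (triangle_hull T)" "x \<in> triangle_hull T'"
  shows "T = T'"
proof (rule triangle_hull_inject[OF T T'], rule ccontr)
  assume ne: "triangle_hull T \<noteq> triangle_hull T'"
  note K = triangle_hull_in_complex[OF T] triangle_hull_in_complex[OF T']
  have sub: "triangle_hull T \<subseteq> triangle_hull T'"
    by (rule simplicial_complex_face_subset[OF complex K x])
  have "triangle_hull T' \<inter> triangle_hull T face_of triangle_hull T'"
    using complex K unfolding simplicial_complex_def by blast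
  then have "triangle_hull T face_of triangle_hull T'"
    using sub by (simp add: Int_absorb1)
  moreover have "convex (triangle_hull T')"
    by (cases T') auto
  ultimately have "aff_dim (triangle_hull T) < aff_dim (triangle_hull T')"
    by (intro face_of_aff_dim_lt ne)
  moreover have "aff_dim (triangle_hull U) = 2" if "U \<in> triangles K r" for U
  proof (cases U)
    case (fields u0 u1 u2)
    note u = triangleD[OF that[unfolded fields]]
    show ?thesis
      using u(2-4) aff_dim_affine_independent[OF u(1)] by (simp add: fields aff_dim_convex_hull)
  qed
  ultimately show False
    using T T' by simp
qed

lemma finitely_many_triangles: "finite (triangles K r)"
proof (rule finite_imageD)
  show "inj_on triangle_hull (triangles K r)"
    using triangle_hull_inject by (intro inj_onI)
  have "triangle_hull ` triangles K r \<subseteq> K"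
    using triangle_hull_in_complex by blast
  then show "finite (triangle_hull ` triangles K r)"
    using complex finite_subset unfolding simplicial_complex_def by blast
qed

lemma edgeD:
  assumes "T \<in> triangles K r" "S \<in> edges_of T"
  shows "fst S \<noteq> snd S" "S \<in> r" "closed_segment (fst S) (snd S) \<in> K"
proof -
  obtain v0 v1 v2 where v: "T = (v0, v1, v2)"
    by (cases T)
  note t = triangleD[OF assms(1)[unfolded v]]
  show "fst S \<noteq> snd S" "S \<in> r"
    using assms(2) t by (auto simp: v)
  have "{fst S, snd S} \<subseteq> {v0, v1, v2}"
    using assms(2) by (auto simp: v)
  then have face: "convex hull {fst S, snd S} face_of convex hull {v0, v1, v2}"
    unfolding face_of_convex_hull_affine_independent[OF t(1)] by (intro exI[of _ "{fst S, snd S}"] conjI refl)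
  have "F \<in> K" if "A \<in> K" "F face_of A" for A F
    using complex that unfolding simplicial_complex_def by blast
  from this[OF t(8) face] show "closed_segment (fst S) (snd S) \<in> K"
    by (simp only: segment_convex_hull)
qed

lemma edges_meet:
  assumes T: "T \<in> triangles K r" "S \<in> edges_of T" and T': "T' \<in> triangles K r" "S' \<in> edges_of T'"
    and x: "x \<in> open_segment (fst S) (snd S)" "x \<in> open_segment (fst S') (snd S')"
  shows "S = S'"
proof -
  note a = edgeD[OF T] and b = edgeD[OF T']
  have "closed_segment (fst S) (snd S) = closed_segment (fst S') (snd S')"
    by (rule simplicial_complex_rel_interiors_disjoint[OF complex a(3) b(3), of x])
       (use x a(1) b(1) in \<open>simp_all add: rel_interior_closed_segment\<close>)
  then have "{fst S, snd S} = {fst S', snd S'}"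
    by (simp only: closed_segment_eq)
  then show ?thesis
    using a(1,2) b(2) antisymD[OF antisym_order] unfolding doubleton_eq_iff
    by (metis prod.collapse)
qed

end

section \<open>Edges of a triangulated surface\<close>

text \<open>
  Coordinates on the triangle \<open>v, w, a\<close> near the midpoint of the edge \<open>v, w\<close>: \<open>s\<close> runs along the edge
  and \<open>t\<close> towards \<open>a\<close>. For \<open>\<bar>s\<bar> < 1/4\<close> and \<open>0 < t < 1/4\<close> all barycentric coordinates are positive.
\<close>
definition half_disc :: "'e::euclidean_space \<Rightarrow> 'e \<Rightarrow> 'e \<Rightarrow> real \<Rightarrow> real \<Rightarrow> 'e" where
  "half_disc v w a s t = midpoint v w + s *\<^sub>R (w - v) + t *\<^sub>R (a - midpoint v w)"

lemma half_disc_barycentric: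
  "half_disc v w a s t = ((1 - t) / 2 - s) *\<^sub>R v + ((1 - t) / 2 + s) *\<^sub>R w + t *\<^sub>R a"
proof -
  have "(x / 2) *\<^sub>R v + (x / 2) *\<^sub>R v = x *\<^sub>R v" for x and v :: 'a
    by (simp flip: scaleR_add_left)
  then show ?thesis
    by (simp add: half_disc_def midpoint_def algebra_simps diff_divide_distrib)
qed

lemma half_disc_in_triangle:
  assumes "\<bar>s\<bar> < 1/4" "0 \<le> t" "t < 1/4"
  shows "half_disc v w a s t \<in> convex hull {v, w, a}"
proof -
  have "0 \<le> (1 - t) / 2 - s" "0 \<le> (1 - t) / 2 + s" "((1 - t) / 2 - s) + ((1 - t) / 2 + s) + t = 1"
    using assms by (auto simp: field_simps)
  then show ?thesis
    unfolding half_disc_barycentric convex_hull_3 using assms(2) by blast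
qed

lemma half_disc_rel_interior:
  assumes "nondegenerate v w a" "\<bar>s\<bar> < 1/4" "0 < t" "t < 1/4"
  shows "half_disc v w a s t \<in> rel_interior (convex hull {v, w, a})"
  unfolding half_disc_barycentric
proof (rule rel_interior_triangle)
  show "0 < (1 - t) / 2 - s" "0 < (1 - t) / 2 + s" "((1 - t) / 2 - s) + ((1 - t) / 2 + s) + t = 1"
    using assms by (auto simp: field_simps)
qed (use assms nondegenerate_distinct[OF assms(1)] in auto)

lemma half_disc_inject:
  assumes nd: "nondegenerate v w a" and eq: "half_disc v w a s t = half_disc v w a s' t'"
  shows "s = s' \<and> t = t'"
proof -
  have half: "half_disc v w a s t = midpoint v w + (s - t / 2) *\<^sub>R (w - v) + t *\<^sub>R (a - v)" for s t
  proof -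
    have "(1/2) *\<^sub>R v + (1/2) *\<^sub>R v = v"
      by (simp flip: scaleR_add_left)
    then have "midpoint v w = v + (1/2) *\<^sub>R (w - v)"
      by (simp add: midpoint_def algebra_simps)
    then have eq: "a - midpoint v w = (a - v) - (1/2) *\<^sub>R (w - v)"
      by simp
    show ?thesis
      unfolding half_disc_def eq by (simp add: algebra_simps)
  qed
  have "((s - t / 2) - (s' - t' / 2)) *\<^sub>R (w - v) + (t - t') *\<^sub>R (a - v) =
        half_disc v w a s t - half_disc v w a s' t'"
    unfolding half by (simp add: algebra_simps)
  then have "((s - t / 2) - (s' - t' / 2)) *\<^sub>R (w - v) + (t - t') *\<^sub>R (a - v) = 0"
    by (simp add: eq)
  then have "(s - t / 2) - (s' - t' / 2) = 0" "t - t' = 0"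
    using nd unfolding nondegenerate_def by blast+
  then show ?thesis
    by simp
qed

text \<open>
  Three different triangles cannot share an edge in a surface. The half discs in the first two
  triangles are glued to a map \<open>p\<close> of an open square into the surface. It is injective, so by
  invariance of domain its image is a neighbourhood of the midpoint of the edge, and there is no room
  for the points of the third triangle near the midpoint.
\<close>
theorem surface_edge_in_two_triangles:
  fixes X :: "'a topology" and v w :: "'e::euclidean_space"
  assumes manifold: "topological_manifold 2 X"
    and h: "homeomorphic_map (top_of_set P) X h"
    and nd: "nondegenerate v w a1" "nondegenerate v w a2" "nondegenerate v w a3"
    and sub: "convex hull {v, w, a1} \<subseteq> P" "convex hull {v, w, a2} \<subseteq> P" "convex hull {v, w, a3} \<subseteq> P"
    and disj12: "rel_interior (convex hull {v, w, a1}) \<inter> convex hull {v, w, a2} = {}"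
    and disj21: "rel_interior (convex hull {v, w, a2}) \<inter> convex hull {v, w, a1} = {}"
    and disj3: "rel_interior (convex hull {v, w, a3}) \<inter> (convex hull {v, w, a1} \<union> convex hull {v, w, a2}) = {}"
  shows False
proof -
  let ?E = "Euclidean_space 2"
  define W0 where "W0 = {x \<in> topspace ?E. \<bar>x 0\<bar> < 1/4 \<and> \<bar>x (Suc 0)\<bar> < 1/4}"
  define p where "p x = midpoint v w + x 0 *\<^sub>R (w - v) + max (x (Suc 0)) 0 *\<^sub>R (a1 - midpoint v w) +
    max (- x (Suc 0)) 0 *\<^sub>R (a2 - midpoint v w)" for x :: "nat \<Rightarrow> real"
  have p_up: "p x = half_disc v w a1 (x 0) (x (Suc 0))" if "0 \<le> x (Suc 0)" for x
    using that by (simp add: p_def half_disc_def)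
  have p_down: "p x = half_disc v w a2 (x 0) (- x (Suc 0))" if "x (Suc 0) \<le> 0" for x
    using that by (simp add: p_def half_disc_def)
  have W0: "\<bar>x 0\<bar> < 1/4" "\<bar>x (Suc 0)\<bar> < 1/4" "x \<in> topspace ?E" if "x \<in> W0" for x
    using that by (auto simp: W0_def)
  have p_in: "p x \<in> convex hull {v, w, a1} \<union> convex hull {v, w, a2}" if "x \<in> W0" for x
  proof (cases "0 \<le> x (Suc 0)")
    case True
    then show ?thesis
      using W0[OF that] p_up[of x] True half_disc_in_triangle[of "x 0" "x (Suc 0)" v w a1] by auto
  next
    case False
    then show ?thesis
      using W0[OF that] p_down[of x] False half_disc_in_triangle[of "x 0" "- x (Suc 0)" v w a2] by auto
  qed
  then have p_P: "p x \<in> P" if "x \<in> W0" for x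
    using that sub(1,2) by blast
  have inj: "inj_on p W0"
  proof (rule inj_onI)
    fix x y assume x: "x \<in> W0" and y: "y \<in> W0" and eq: "p x = p y"
    have "x 0 = y 0 \<and> x (Suc 0) = y (Suc 0)"
    proof -
      consider "0 \<le> x (Suc 0)" "0 \<le> y (Suc 0)" | "x (Suc 0) \<le> 0" "y (Suc 0) \<le> 0"
        | "0 < x (Suc 0)" "y (Suc 0) \<le> 0" | "x (Suc 0) \<le> 0" "0 < y (Suc 0)"
        by linarith
      then show ?thesis
      proof cases
        case 1
        then show ?thesis
          using half_disc_inject[OF nd(1)] eq by (simp add: p_up)
      next
        case 2
        then show ?thesis
          using half_disc_inject[OF nd(2), of "x 0" "- x (Suc 0)" "y 0" "- y (Suc 0)"] eq by (simp add: p_down)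
      next
        case 3
        then have "p x \<in> rel_interior (convex hull {v, w, a1})"
          using half_disc_rel_interior[OF nd(1), of "x 0" "x (Suc 0)"] W0[OF x] by (simp add: p_up)
        moreover have "p y \<in> convex hull {v, w, a2}"
          using half_disc_in_triangle[of "y 0" "- y (Suc 0)" v w a2] W0[OF y] 3 by (simp add: p_down)
        ultimately show ?thesis
          using disj12 eq by (metis IntI empty_iff)
      next
        case 4
        then have "p y \<in> rel_interior (convex hull {v, w, a1})"
          using half_disc_rel_interior[OF nd(1), of "y 0" "y (Suc 0)"] W0[OF y] by (simp add: p_up)
        moreover have "p x \<in> convex hull {v, w, a2}"
          using half_disc_in_triangle[of "x 0" "- x (Suc 0)" v w a2] W0[OF x] 4 by (simp add: p_down)
        ultimately show ?thesis
          using disj12 eq by (metis IntI empty_iff)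
      qed
    qed
    moreover have "x i = y i" if "2 \<le> i" for i
      using W0(3)[OF x] W0(3)[OF y] that by (simp add: topspace_Euclidean_space)
    ultimately show "x = y"
      by (intro ext) (metis One_nat_def less_2_cases not_le)
  qed
  have coord: "continuous_map ?E euclideanreal (\<lambda>x. x i)" for i
    unfolding Euclidean_space_def
    by (intro continuous_map_from_subtopology continuous_map_product_projection) auto
  have "openin ?E {x \<in> topspace ?E. x 0 \<in> {-1/4<..<1/4}}" "openin ?E {x \<in> topspace ?E. x (Suc 0) \<in> {-1/4<..<1/4}}"
    by (rule openin_continuous_map_preimage[OF coord]; simp)+
  then have "openin ?E ({x \<in> topspace ?E. x 0 \<in> {-1/4<..<1/4}} \<inter> {x \<in> topspace ?E. x (Suc 0) \<in> {-1/4<..<1/4}})"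
    by (rule openin_Int)
  moreover have "{x \<in> topspace ?E. x 0 \<in> {-1/4<..<1/4}} \<inter> {x \<in> topspace ?E. x (Suc 0) \<in> {-1/4<..<1/4}} = W0"
    by (auto simp: W0_def abs_less_iff)
  ultimately have open_W0: "openin ?E W0"
    by simp
  have "continuous_on UNIV p"
    unfolding p_def by (intro continuous_intros continuous_on_product_coordinates)
  then have "continuous_map ?E euclidean p"
    unfolding Euclidean_space_def
    by (intro continuous_map_from_subtopology) (simp add: euclidean_product_topology)
  then have p_cont: "continuous_map (subtopology ?E W0) (top_of_set P) p"
    using p_P by (auto simp: continuous_map_in_subtopology continuous_map_from_subtopology)
  then have hp_cont: "continuous_map (subtopology ?E W0) X (h \<circ> p)"
    using homeomorphic_imp_continuous_map[OF h] by (rule continuous_map_compose)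
  \<comment> \<open>The midpoint of the edge has a neighbourhood homeomorphic to an open subset of the plane.\<close>
  have zero: "(\<lambda>_. 0) \<in> W0"
    by (simp add: W0_def topspace_Euclidean_space)
  have p0: "p (\<lambda>_. 0) = midpoint v w"
    by (simp add: p_def)
  have "h (p (\<lambda>_. 0)) \<in> topspace X"
    using homeomorphic_imp_surjective_map[OF h] p_P[OF zero] by auto
  then obtain U V where U: "openin X U" "h (p (\<lambda>_. 0)) \<in> U" and V: "openin ?E V"
    and "subtopology X U homeomorphic_space subtopology ?E V"
    using manifold unfolding topological_manifold_def by blast
  then obtain k where k: "homeomorphic_map (subtopology X U) (subtopology ?E V) k"
    unfolding homeomorphic_space by blast
  define W where "W = {x \<in> W0. h (p x) \<in> U}"
  have "openin (subtopology ?E W0) {x \<in> topspace (subtopology ?E W0). (h \<circ> p) x \<in> U}"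
    by (rule openin_continuous_map_preimage[OF hp_cont U(1)])
  moreover have "{x \<in> topspace (subtopology ?E W0). (h \<circ> p) x \<in> U} = W"
    using openin_subset[OF open_W0] by (auto simp: W_def)
  ultimately have open_W: "openin ?E W"
    using openin_trans_full open_W0 by metis
  have W_W0: "W \<subseteq> W0"
    by (auto simp: W_def)
  have hpW: "(h \<circ> p) ` W \<subseteq> U"
    by (auto simp: W_def)
  have "continuous_map (subtopology ?E W) (subtopology X U) (h \<circ> p)"
    using continuous_map_from_subtopology_mono[OF hp_cont W_W0] hpW
    by (auto simp: continuous_map_in_subtopology)
  then have "continuous_map (subtopology ?E W) (subtopology ?E V) (k \<circ> (h \<circ> p))"
    using homeomorphic_imp_continuous_map[OF k] by (rule continuous_map_compose)
  then have "continuous_map (subtopology ?E W) ?E (k \<circ> (h \<circ> p))"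
    by (simp add: continuous_map_in_subtopology)
  moreover have "inj_on (k \<circ> (h \<circ> p)) W"
  proof (intro comp_inj_on)
    show "inj_on p W"
      using inj W_W0 by (rule inj_on_subset)
    have "p ` W \<subseteq> topspace (top_of_set P)"
      using p_P W_W0 by auto
    then show "inj_on h (p ` W)"
      using homeomorphic_imp_injective_map[OF h] by (rule inj_on_subset[rotated])
    have "(h \<circ> p) ` W \<subseteq> topspace (subtopology X U)"
      using hpW openin_subset[OF U(1)] by auto
    then show "inj_on k ((h \<circ> p) ` W)"
      using homeomorphic_imp_injective_map[OF k] by (rule inj_on_subset[rotated])
  qed
  ultimately have open_k: "openin ?E ((k \<circ> (h \<circ> p)) ` W)"
    by (rule invariance_of_domain_Euclidean_space[OF open_W])
  have hpW': "(h \<circ> p) ` W \<subseteq> topspace (subtopology X U)"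
    using hpW openin_subset[OF U(1)] by auto
  have "k ` ((h \<circ> p) ` W) \<subseteq> V"
    using image_mono[OF hpW', of k] unfolding homeomorphic_imp_surjective_map[OF k] by auto
  then have "openin (subtopology ?E V) (k ` ((h \<circ> p) ` W))"
    using open_k by (auto simp: image_comp intro: openin_subset_topspace_eq subset_openin_subtopology)
  then have "openin (subtopology X U) ((h \<circ> p) ` W)"
    using homeomorphic_map_openness[OF k hpW'] by simp
  then have "openin X (h ` (p ` W))"
    using openin_trans_full U(1) by (metis image_comp)
  moreover have "p ` W \<subseteq> topspace (top_of_set P)"
    using p_P W_W0 by auto
  ultimately have open_pW: "openin (top_of_set P) (p ` W)"
    using homeomorphic_map_openness[OF h] by blast
  have "midpoint v w \<in> p ` W"
    using zero U(2) p0 by (auto simp: W_def intro!: image_eqI[of _ _ "\<lambda>_. 0"])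
  then obtain e where e: "0 < e" "ball (midpoint v w) e \<inter> P \<subseteq> p ` W"
    using open_pW unfolding openin_contains_ball by blast
  \<comment> \<open>Points of the third triangle near the midpoint must lie in the two half discs.\<close>
  define d where "d = norm (a3 - midpoint v w)"
  define t where "t = min (1/8) (e / (2 * (d + 1)))"
  have d: "0 \<le> d"
    by (simp add: d_def)
  have t: "0 < t" "t < 1/4"
    using e d by (auto simp: t_def)
  have "t * d \<le> e / (2 * (d + 1)) * d"
    using d by (intro mult_right_mono) (auto simp: t_def)
  also have "\<dots> < e"
    using e d by (simp add: field_simps) (smt (verit) mult_nonneg_nonneg)
  finally have "dist (midpoint v w) (half_disc v w a3 0 t) < e"
    using t by (simp add: half_disc_def dist_norm d_def)
  moreover have "half_disc v w a3 0 t \<in> P"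
    using half_disc_in_triangle[of 0 t v w a3] t sub(3) by auto
  ultimately have "half_disc v w a3 0 t \<in> p ` W"
    using e by auto
  then obtain x where "x \<in> W" "half_disc v w a3 0 t = p x"
    by blast
  then have "half_disc v w a3 0 t \<in> convex hull {v, w, a1} \<union> convex hull {v, w, a2}"
    using p_in[of x] W_W0 by auto
  moreover have "half_disc v w a3 0 t \<in> rel_interior (convex hull {v, w, a3})"
    using half_disc_rel_interior[OF nd(3), of 0 t] t by simp
  ultimately show False
    using disj3 by blast
qed

section \<open>Closing up oriented segments to loops\<close>

lemma loop_sides_corners:
  assumes "(p, q) \<in> loop_sides ps"
  shows "p \<in> set ps" "q \<in> set ps"
  using assms set_zip_leftD[of p q ps "rotate1 ps"] set_zip_rightD[of p q ps "rotate1 ps"]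
  by (simp_all add: loop_sides_def)

text \<open>
  \<open>support \<sigma> a\<close> lists the orbit of \<open>a\<close> in the order in which \<open>\<sigma>\<close> runs through it, so \<open>\<sigma>\<close> acts on this
  list as rotation by one place.
\<close>
lemma loop_sides_support:
  assumes "permutation \<sigma>"
  shows "loop_sides (support \<sigma> a) = (\<lambda>x. (x, \<sigma> x)) ` set (support \<sigma> a)"
proof -
  let ?c = "support \<sigma> a"
  have "rotate1 ?c = map (cycle_of_list ?c) ?c"
    using cyclic_rotation[OF cycle_of_permutation[OF assms], of 1 a] by simp
  also have "\<dots> = map \<sigma> ?c"
    using cycle_restrict[OF assms, of _ a] by (intro map_cong refl) simp
  finally have "zip ?c (rotate1 ?c) = map (\<lambda>x. (x, \<sigma> x)) ?c"
    by (simp only: zip_map2 zip_same_conv_map) (simp add: comp_def)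
  then show ?thesis
    unfolding loop_sides_def by (simp only: set_map)
qed

text \<open>
  The hypotheses say that at each vertex of \<open>A\<close> exactly one arrow starts and exactly one ends. So
  following the arrows is a permutation of the finite set of vertices, and its orbits are the loops.
\<close>
theorem arrows_form_loops:
  fixes A :: "('v \<times> 'v) set"
  assumes fin: "finite A" and inj: "inj_on fst A" "inj_on snd A" and closed: "fst ` A = snd ` A"
  shows "\<exists>\<Gamma>. finite \<Gamma> \<and> (\<forall>ps\<in>\<Gamma>. ps \<noteq> [] \<and> distinct ps) \<and>
    (\<forall>ps\<in>\<Gamma>. \<forall>qs\<in>\<Gamma>. ps \<noteq> qs \<longrightarrow> set ps \<inter> set qs = {}) \<and> (\<Union>ps\<in>\<Gamma>. loop_sides ps) = A"
proof -
  let ?V = "fst ` A"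
  define \<sigma> where "\<sigma> x = (if x \<in> ?V then snd (inv_into A fst x) else x)" for x
  have arrow: "(x, \<sigma> x) \<in> A" if "x \<in> ?V" for x
  proof -
    have "inv_into A fst x \<in> A" "fst (inv_into A fst x) = x"
      using that by (auto intro: inv_into_into f_inv_into_f)
    then show ?thesis
      using that by (metis \<sigma>_def prod.collapse)
  qed
  have A_eq: "A = (\<lambda>x. (x, \<sigma> x)) ` ?V"
  proof (intro equalityI subsetI)
    fix y assume y: "y \<in> A"
    then have "(fst y, \<sigma> (fst y)) \<in> A"
      using arrow by blast
    then have "y = (fst y, \<sigma> (fst y))"
      using inj_onD[OF inj(1), of y "(fst y, \<sigma> (fst y))"] y by simp
    then show "y \<in> (\<lambda>x. (x, \<sigma> x)) ` ?V"
      using y by (metis imageI)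
  qed (use arrow in blast)
  have bij: "bij_betw \<sigma> ?V ?V"
  proof -
    have "bij_betw (snd \<circ> inv_into A fst) ?V (snd ` A)"
      by (intro bij_betw_trans[of _ _ A] bij_betw_inv_into inj_on_imp_bij_betw inj)
    then have "bij_betw (snd \<circ> inv_into A fst) ?V ?V"
      by (simp only: closed)
    then show ?thesis
      by (rule bij_betw_cong[THEN iffD1, rotated]) (simp add: \<sigma>_def)
  qed
  have perm: "\<sigma> permutes ?V"
    using bij by (rule bij_imp_permutes) (simp add: \<sigma>_def)
  then have permutation: "permutation \<sigma>"
    using fin permutation_permutes by blast
  have self: "a \<in> set (support \<sigma> a)" for a
    unfolding support_set[OF permutation] by (rule image_eqI[of _ _ 0]) auto
  have sub: "set (support \<sigma> a) \<subseteq> ?V" if "a \<in> ?V" for a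
    unfolding support_set[OF permutation]
    using permutes_in_image[OF permutes_funpow[OF perm]] that by blast
  have orbits: "set (support \<sigma> a) = set (support \<sigma> b)" if "set (support \<sigma> a) \<inter> set (support \<sigma> b) \<noteq> {}" for a b
    using disjoint_support[OF permutation] that unfolding disjoint_def by blast
  \<comment> \<open>One starting point is chosen on each orbit.\<close>
  define loop where "loop a = support \<sigma> (SOME b. set (support \<sigma> b) = set (support \<sigma> a))" for a
  have set_loop: "set (loop a) = set (support \<sigma> a)" for a
    unfolding loop_def by (rule someI[of "\<lambda>b. set (support \<sigma> b) = set (support \<sigma> a)"]) (rule refl)
  have loop_eq: "loop a = loop b" if "set (loop a) \<inter> set (loop b) \<noteq> {}" for a b
  proof -
    have "set (support \<sigma> a) = set (support \<sigma> b)"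
      using that unfolding set_loop by (rule orbits)
    then show ?thesis
      unfolding loop_def by (simp only:)
  qed
  have sides: "loop_sides (loop a) = (\<lambda>x. (x, \<sigma> x)) ` set (loop a)" for a
    unfolding loop_def by (rule loop_sides_support[OF permutation])
  have "(\<Union>ps\<in>loop ` ?V. loop_sides ps) = (\<lambda>x. (x, \<sigma> x)) ` (\<Union>a\<in>?V. set (support \<sigma> a))"
    unfolding image_UN UN_simps(10) sides set_loop ..
  also have "(\<Union>a\<in>?V. set (support \<sigma> a)) = ?V"
    using self sub by blast
  finally have "(\<Union>ps\<in>loop ` ?V. loop_sides ps) = A"
    using A_eq by simp
  moreover have "distinct (loop a)" for a
    unfolding loop_def by (rule cycle_of_permutation[OF permutation])
  moreover have "loop a \<noteq> []" for a
    using self[of a] set_loop[of a] by force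
  moreover have "set ps \<inter> set qs = {}" if "ps \<in> loop ` ?V" "qs \<in> loop ` ?V" "ps \<noteq> qs" for ps qs
    using that loop_eq by blast
  moreover have "finite (loop ` ?V)"
    using fin by simp
  ultimately show ?thesis
    by (intro exI[of _ "loop ` ?V"] conjI ballI impI) auto
qed

section \<open>Level loops on a triangulated surface\<close>

locale triangulated_surface =
  ordered_complex K r + balanced_triangles X "\<Union>K" h "triangles K r" \<epsilon>
  for X :: "'a topology"
    and K :: "'e::euclidean_space set set"
    and h :: "'e \<Rightarrow> 'a"
    and r :: "('e \<times> 'e) set"
    and \<epsilon> :: "'e \<times> 'e \<times> 'e \<Rightarrow> int" +
  assumes manifold: "topological_manifold 2 X"
    and homeomorphism: "homeomorphic_map (top_of_set (\<Union>K)) X h"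
    and signs: "T \<in> triangles K r \<Longrightarrow> \<epsilon> T \<in> {1, - 1}"
begin

abbreviation "Ts \<equiv> triangles K r"

text \<open>
  Brings the three edges of an ordered triangle to the common form that the gluing of half discs
  requires.
\<close>
lemma opposite_vertex:
  assumes T: "T \<in> Ts" and S: "S \<in> edges_of T"
  shows "\<exists>a. triangle_hull T = convex hull {fst S, snd S, a} \<and> nondegenerate (fst S) (snd S) a"
proof -
  obtain v0 v1 v2 where v: "T = (v0, v1, v2)"
    by (cases T)
  have nd: "nondegenerate v0 v1 v2"
    using triangle_nondegenerate T v by simp
  then have nd': "nondegenerate v1 v2 v0" "nondegenerate v0 v2 v1"
    using nondegenerate_rotate nondegenerate_swap by blast+
  have "S = (v0, v1) \<or> S = (v0, v2) \<or> S = (v1, v2)"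
    using S by (simp add: v)
  then show ?thesis
  proof (elim disjE)
    assume "S = (v0, v1)"
    then show ?thesis
      using nd by (intro exI[of _ v2]) (simp add: v)
  next
    assume "S = (v0, v2)"
    then show ?thesis
      using nd' by (intro exI[of _ v1]) (simp add: v insert_commute)
  next
    assume "S = (v1, v2)"
    then show ?thesis
      using nd' by (intro exI[of _ v0]) (simp add: v insert_commute)
  qed
qed

lemma edge_in_at_most_two_triangles:
  assumes T: "T1 \<in> Ts" "T2 \<in> Ts" "T3 \<in> Ts" and S: "S \<in> edges_of T1" "S \<in> edges_of T2" "S \<in> edges_of T3"
    and ne: "T1 \<noteq> T2"
  shows "T3 = T1 \<or> T3 = T2"
proof (rule ccontr)
  assume ne3: "\<not> (T3 = T1 \<or> T3 = T2)"
  obtain a1 where 1: "triangle_hull T1 = convex hull {fst S, snd S, a1}" "nondegenerate (fst S) (snd S) a1"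
    using opposite_vertex[OF T(1) S(1)] by blast
  obtain a2 where 2: "triangle_hull T2 = convex hull {fst S, snd S, a2}" "nondegenerate (fst S) (snd S) a2"
    using opposite_vertex[OF T(2) S(2)] by blast
  obtain a3 where 3: "triangle_hull T3 = convex hull {fst S, snd S, a3}" "nondegenerate (fst S) (snd S) a3"
    using opposite_vertex[OF T(3) S(3)] by blast
  have disj: "rel_interior (triangle_hull T) \<inter> triangle_hull T' = {}"
    if "T \<in> Ts" "T' \<in> Ts" "T \<noteq> T'" for T T'
    using triangles_meet_in_boundary[OF that(1,2)] that(3) by blast
  show False
    by (rule surface_edge_in_two_triangles[OF manifold homeomorphism 1(2) 2(2) 3(2)]; fold 1(1) 2(1) 3(1))
       (use triangle_subset disj T ne ne3 in blast)+
qed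

lemma incidence_sign:
  assumes T: "T \<in> Ts" and S: "S \<in> edges_of T"
  shows "\<epsilon> T * incidence S T \<in> {1, - 1}"
proof (cases T)
  case (fields v0 v1 v2)
  then show ?thesis
    using signs[OF T] S incidence_edges[of v0 v1 v2] T by auto
qed

text \<open>
  If all triangles at the edge induced the same orientation, its coefficient in the boundary of the
  fundamental cycle would not vanish.
\<close>
lemma oppositely_oriented_neighbour:
  assumes T: "T \<in> Ts" and S: "S \<in> edges_of T"
  shows "\<exists>T'\<in>Ts. S \<in> edges_of T' \<and> \<epsilon> T' * incidence S T' = - (\<epsilon> T * incidence S T)"
proof (rule ccontr)
  assume no: "\<not> ?thesis"
  let ?A = "{T \<in> Ts. S \<in> edges_of T}"
  have same: "\<epsilon> T' * incidence S T' = \<epsilon> T * incidence S T" if "T' \<in> ?A" for T'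
    using no incidence_sign[OF T S] incidence_sign[of T' S] that by auto
  have "0 = (\<Sum>T'\<in>?A. \<epsilon> T' * incidence S T')"
    unfolding balance[of S, symmetric]
  proof (rule sum.mono_neutral_right[OF finite_triangles])
    show "\<forall>T'\<in>Ts - ?A. \<epsilon> T' * incidence S T' = 0"
      using incidence_outside[of S] by simp
  qed simp
  also have "\<dots> = of_nat (card ?A) * (\<epsilon> T * incidence S T)"
    using same by simp
  finally have "card ?A = 0"
    using incidence_sign[OF T S] by auto
  moreover have "finite ?A"
    using finite_triangles by simp
  moreover have "T \<in> ?A"
    using T S by blast
  ultimately show False
    by (metis card_0_eq empty_iff)
qed

lemma coherently_oriented_triangle_unique:
  assumes T: "T \<in> Ts" "S \<in> edges_of T" and T': "T' \<in> Ts" "S \<in> edges_of T'"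
    and eq: "\<epsilon> T * incidence S T = \<epsilon> T' * incidence S T'"
  shows "T = T'"
proof (rule ccontr)
  assume ne: "T \<noteq> T'"
  obtain T'' where T'': "T'' \<in> Ts" "S \<in> edges_of T''" "\<epsilon> T'' * incidence S T'' = - (\<epsilon> T * incidence S T)"
    using oppositely_oriented_neighbour[OF T] by blast
  then have "T'' = T \<or> T'' = T'"
    using edge_in_at_most_two_triangles T T' ne by blast
  then show False
    using T''(3) eq incidence_sign[OF T] by auto
qed

lemma level_segments_UN: "level_segments Ts \<epsilon> \<phi> = (\<Union>T\<in>Ts. level_segments {T} \<epsilon> \<phi>)"
  unfolding level_segments_def by blast

lemma level_triangle_exists:
  assumes T: "(v0, v1, v2) \<in> Ts" and \<phi>: "\<phi> \<in> cocycles Ts"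
  shows "\<exists>n. level_triangle v0 v1 v2 n \<phi> (\<epsilon> (v0, v1, v2))"
proof -
  have nd: "nondegenerate v0 v1 v2"
    by (rule triangle_nondegenerate[OF T])
  obtain n where "in_plane v0 v1 v2 n" "n \<bullet> (v1 - v0) = of_int (\<phi> (v0, v1))" "n \<bullet> (v2 - v0) = of_int (\<phi> (v0, v2))"
    using exists_gradient[OF nd] by blast
  then show ?thesis
    using nd signs[OF T] \<phi> T by (intro exI[of _ n] level_triangle.intro) (auto simp: cocycles_def)
qed

lemma level_segments_singleton: "level_segments {T} \<epsilon> \<phi> = level_segments {T} (\<lambda>_. \<epsilon> T) \<phi>"
  unfolding level_segments_def by simp

context
  fixes \<phi> assumes \<phi>: "\<phi> \<in> cocycles Ts"
begin

abbreviation "segs T \<equiv> level_segments {T} \<epsilon> \<phi>"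
abbreviation "crossings T \<equiv> edge_crossings (\<epsilon> T) \<phi> T"

lemma bij_betw_segs:
  assumes "T \<in> Ts"
  shows "bij_betw fst (segs T) (crossings T 1)" "bij_betw snd (segs T) (crossings T (- 1))"
proof -
  obtain v0 v1 v2 where v: "T = (v0, v1, v2)"
    by (cases T)
  obtain n where "level_triangle v0 v1 v2 n \<phi> (\<epsilon> (v0, v1, v2))"
    using level_triangle_exists \<phi> assms v by blast
  then interpret level_triangle v0 v1 v2 n \<phi> "\<epsilon> (v0, v1, v2)" .
  show "bij_betw fst (segs T) (crossings T 1)" "bij_betw snd (segs T) (crossings T (- 1))"
    using bij_betw_starts bij_betw_ends unfolding v level_segments_singleton[of "(v0, v1, v2)"] by blast+
qed

lemma segs_geometry:
  assumes T: "T \<in> Ts" and pq: "(p, q) \<in> segs T"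
  shows "p \<noteq> q" "closed_segment p q \<subseteq> triangle_hull T"
    "x \<in> closed_segment p q \<Longrightarrow> x \<noteq> p \<Longrightarrow> x \<noteq> q \<Longrightarrow> x \<in> rel_interior (triangle_hull T)"
    "(p', q') \<in> segs T \<Longrightarrow> x \<in> closed_segment p q \<Longrightarrow> x \<in> closed_segment p' q' \<Longrightarrow> p = p' \<and> q = q'"
proof -
  obtain v0 v1 v2 where v: "T = (v0, v1, v2)"
    by (cases T)
  obtain n where "level_triangle v0 v1 v2 n \<phi> (\<epsilon> (v0, v1, v2))"
    using level_triangle_exists \<phi> T v by blast
  then interpret level_triangle v0 v1 v2 n \<phi> "\<epsilon> (v0, v1, v2)" .
  have pq': "(p, q) \<in> segments"
    using pq unfolding v level_segments_singleton[of "(v0, v1, v2)"] .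
  show "p \<noteq> q"
    by (rule segments_nontrivial[OF pq'])
  show "closed_segment p q \<subseteq> triangle_hull T"
    using pq' unfolding segments_iff by (auto simp: level_set_def v)
  show "x \<in> closed_segment p q \<Longrightarrow> x \<noteq> p \<Longrightarrow> x \<noteq> q \<Longrightarrow> x \<in> rel_interior (triangle_hull T)"
    using segments_interior[OF pq'] by (simp add: v)
  show "(p', q') \<in> segs T \<Longrightarrow> x \<in> closed_segment p q \<Longrightarrow> x \<in> closed_segment p' q' \<Longrightarrow> p = p' \<and> q = q'"
    unfolding v level_segments_singleton[of "(v0, v1, v2)"] by (rule segments_meet[OF pq'])
qed

lemma finite_crossings: "finite (crossings T \<sigma>)"
  unfolding edge_crossings_def
  by (intro finite_UN_I finite_level_points) (simp add: finite_edges_of)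

lemma finite_segs: "T \<in> Ts \<Longrightarrow> finite (segs T)"
  using bij_betw_finite[OF bij_betw_segs(1)] finite_crossings by blast

lemma segs_disjoint:
  assumes T: "T \<in> Ts" and T': "T' \<in> Ts" and "segs T \<inter> segs T' \<noteq> {}"
  shows "T = T'"
proof -
  obtain p q where pq: "(p, q) \<in> segs T" "(p, q) \<in> segs T'"
    using assms(3) by auto
  have ne: "p \<noteq> q"
    by (rule segs_geometry(1)[OF T pq(1)])
  have mid: "midpoint p q \<in> closed_segment p q"
    by simp
  then have "midpoint p q \<in> rel_interior (triangle_hull T)"
    using segs_geometry(3)[OF T pq(1)] ne by simp
  moreover have "midpoint p q \<in> triangle_hull T'"
    using segs_geometry(2)[OF T' pq(2)] mid by blast
  ultimately show ?thesis
    by (rule triangles_meet_in_boundary[OF T T'])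
qed

text \<open>
  Within one triangle different level segments are disjoint. In different triangles, a common point
  lies in the interior of neither, and only the end points of level segments lie on edges.
\<close>
lemma segs_meet_at_endpoints:
  assumes T: "T \<in> Ts" "(p, q) \<in> segs T" and T': "T' \<in> Ts" "(p', q') \<in> segs T'"
    and x: "x \<in> closed_segment p q" "x \<in> closed_segment p' q'"
  shows "p = p' \<and> q = q' \<or> x \<in> {p, q} \<and> x \<in> {p', q'}"
proof (cases "T = T'")
  case True
  then show ?thesis
    using segs_geometry(4)[OF T, of p' q' x] T'(2) x by simp
next
  case False
  have "x \<in> triangle_hull T" "x \<in> triangle_hull T'"
    using segs_geometry(2)[OF T] segs_geometry(2)[OF T'] x by blast+
  then have "x \<notin> rel_interior (triangle_hull T)" "x \<notin> rel_interior (triangle_hull T')"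
    using triangles_meet_in_boundary[OF T(1) T'(1)] triangles_meet_in_boundary[OF T'(1) T(1)] False
    by blast+
  then show ?thesis
    using segs_geometry(3)[OF T x(1)] segs_geometry(3)[OF T' x(2)] by blast
qed

lemma level_point_edge_unique:
  assumes "T \<in> Ts" "S \<in> edges_of T" "T' \<in> Ts" "S' \<in> edges_of T'"
    and "x \<in> level_points \<phi> S" "x \<in> level_points \<phi> S'"
  shows "S = S'"
  using edges_meet[OF assms(1-4), of x] assms(5,6)
    level_points_open_segment[OF edgeD(1)[OF assms(1,2)]]
    level_points_open_segment[OF edgeD(1)[OF assms(3,4)]] by blast

lemma crossings_triangle_unique:
  assumes T: "T \<in> Ts" and T': "T' \<in> Ts" and x: "x \<in> crossings T \<sigma>" "x \<in> crossings T' \<sigma>"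
    and \<sigma>: "\<sigma> \<noteq> 0"
  shows "T = T'"
proof -
  obtain S where S: "S \<in> edges_of T" "\<epsilon> T * incidence S T * sgn (\<phi> S) = \<sigma>" "x \<in> level_points \<phi> S"
    using x(1) unfolding edge_crossings_def by blast
  obtain S' where S': "S' \<in> edges_of T'" "\<epsilon> T' * incidence S' T' * sgn (\<phi> S') = \<sigma>" "x \<in> level_points \<phi> S'"
    using x(2) unfolding edge_crossings_def by blast
  have eq: "S = S'"
    by (rule level_point_edge_unique[OF T S(1) T' S'(1) S(3) S'(3)])
  have "sgn (\<phi> S) \<noteq> 0"
    using S(2) \<sigma> by auto
  moreover have "\<epsilon> T * incidence S T * sgn (\<phi> S) = \<epsilon> T' * incidence S T' * sgn (\<phi> S)"
    using S(2) S'(2) eq by (simp only:)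
  ultimately have "\<epsilon> T * incidence S T = \<epsilon> T' * incidence S T'"
    by simp
  then show ?thesis
    using coherently_oriented_triangle_unique[OF T S(1) T'] S'(1) eq by simp
qed

text \<open>The triangle on the other side of the edge traverses it in the opposite direction.\<close>
lemma crossings_neighbour:
  assumes T: "T \<in> Ts" and x: "x \<in> crossings T \<sigma>"
  shows "\<exists>T'\<in>Ts. x \<in> crossings T' (- \<sigma>)"
proof -
  obtain S where S: "S \<in> edges_of T" "\<epsilon> T * incidence S T * sgn (\<phi> S) = \<sigma>" "x \<in> level_points \<phi> S"
    using x unfolding edge_crossings_def by blast
  obtain T' where T': "T' \<in> Ts" "S \<in> edges_of T'" "\<epsilon> T' * incidence S T' = - (\<epsilon> T * incidence S T)"
    using oppositely_oriented_neighbour[OF T S(1)] by blast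
  have "\<epsilon> T' * incidence S T' * sgn (\<phi> S) = - \<sigma>"
    unfolding T'(3) using S(2) by simp
  then have "x \<in> crossings T' (- \<sigma>)"
    unfolding edge_crossings_def using S(3) T'(2) by blast
  then show ?thesis
    using T'(1) by blast
qed

lemma finite_level_segments: "finite (level_segments Ts \<epsilon> \<phi>)"
  unfolding level_segments_UN using finite_triangles finite_segs by blast

lemma inj_on_level_segments:
  "inj_on fst (level_segments Ts \<epsilon> \<phi>)" "inj_on snd (level_segments Ts \<epsilon> \<phi>)"
proof -
  have unique: "y = z"
    if bij: "\<And>T. T \<in> Ts \<Longrightarrow> bij_betw f (segs T) (crossings T \<sigma>)" and "\<sigma> \<noteq> 0"
      and yz: "y \<in> level_segments Ts \<epsilon> \<phi>" "z \<in> level_segments Ts \<epsilon> \<phi>" "f y = f z" for f \<sigma> y z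
  proof -
    obtain T where T: "T \<in> Ts" "y \<in> segs T"
      using yz(1) unfolding level_segments_UN by blast
    obtain T' where T': "T' \<in> Ts" "z \<in> segs T'"
      using yz(2) unfolding level_segments_UN by blast
    have "f y \<in> crossings T \<sigma>" "f z \<in> crossings T' \<sigma>"
      using bij_betwE[OF bij[OF T(1)]] bij_betwE[OF bij[OF T'(1)]] T(2) T'(2) by blast+
    then have "T = T'"
      using crossings_triangle_unique[OF T(1) T'(1)] yz(3) \<open>\<sigma> \<noteq> 0\<close> by simp
    then show "y = z"
      using bij_betw_imp_inj_on[OF bij[OF T(1)]] T(2) T'(2) yz(3) by (auto dest: inj_onD)
  qed
  show "inj_on fst (level_segments Ts \<epsilon> \<phi>)"
    by (rule inj_onI, rule unique[OF bij_betw_segs(1)]) auto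
  show "inj_on snd (level_segments Ts \<epsilon> \<phi>)"
    by (rule inj_onI, rule unique[OF bij_betw_segs(2)]) auto
qed

lemma level_segments_closed: "fst ` level_segments Ts \<epsilon> \<phi> = snd ` level_segments Ts \<epsilon> \<phi>"
proof -
  have "fst ` level_segments Ts \<epsilon> \<phi> = (\<Union>T\<in>Ts. crossings T 1)"
    unfolding level_segments_UN image_UN using bij_betw_imp_surj_on[OF bij_betw_segs(1)] by auto
  also have "\<dots> = (\<Union>T\<in>Ts. crossings T (- 1))"
    using crossings_neighbour[of _ _ 1] crossings_neighbour[of _ _ "- 1"] by auto
  also have "\<dots> = snd ` level_segments Ts \<epsilon> \<phi>"
    unfolding level_segments_UN image_UN using bij_betw_imp_surj_on[OF bij_betw_segs(2)] by auto
  finally show ?thesis .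
qed

text \<open>
  Loops with disjoint sets of corners are disjoint as curves, because different level segments meet
  in common end points only.
\<close>
theorem level_loops_exist: "\<exists>\<Gamma>. level_loops Ts \<epsilon> \<phi> \<Gamma>"
proof -
  obtain \<Gamma> where \<Gamma>: "finite \<Gamma>" "\<forall>ps\<in>\<Gamma>. ps \<noteq> [] \<and> distinct ps"
    and disj: "\<forall>ps\<in>\<Gamma>. \<forall>qs\<in>\<Gamma>. ps \<noteq> qs \<longrightarrow> set ps \<inter> set qs = {}"
    and sides: "(\<Union>ps\<in>\<Gamma>. loop_sides ps) = level_segments Ts \<epsilon> \<phi>"
    using arrows_form_loops[OF finite_level_segments inj_on_level_segments level_segments_closed]
    by (elim exE conjE)
  have side: "\<exists>T\<in>Ts. (p, q) \<in> segs T" if "ps \<in> \<Gamma>" "(p, q) \<in> loop_sides ps" for ps p q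
  proof -
    have "(p, q) \<in> level_segments Ts \<epsilon> \<phi>"
      unfolding sides[symmetric] using that by blast
    then show ?thesis
      unfolding level_segments_UN by (simp only: UN_iff)
  qed
  have "loop_image ps \<inter> loop_image qs = {}" if ps: "ps \<in> \<Gamma>" "qs \<in> \<Gamma>" "ps \<noteq> qs" for ps qs
  proof (rule ccontr)
    assume "loop_image ps \<inter> loop_image qs \<noteq> {}"
    then obtain x where "x \<in> loop_image ps" "x \<in> loop_image qs"
      by blast
    then obtain p q p' q' where pq: "(p, q) \<in> loop_sides ps" "(p', q') \<in> loop_sides qs"
      and x: "x \<in> closed_segment p q" "x \<in> closed_segment p' q'"
      unfolding loop_image_def by fast
    obtain T T' where "T \<in> Ts" "(p, q) \<in> segs T" "T' \<in> Ts" "(p', q') \<in> segs T'"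
      using side[OF ps(1) pq(1)] side[OF ps(2) pq(2)] by (elim bexE)
    then have "p = p' \<and> q = q' \<or> x \<in> {p, q} \<and> x \<in> {p', q'}"
      by (rule segs_meet_at_endpoints[OF _ _ _ _ x])
    then have "set ps \<inter> set qs \<noteq> {}"
      using loop_sides_corners[OF pq(1)] loop_sides_corners[OF pq(2)] by auto
    then show False
      using disj ps by blast
  qed
  then have "level_loops Ts \<epsilon> \<phi> \<Gamma>"
    unfolding level_loops_def using \<Gamma> sides by (intro conjI ballI impI) simp_all
  then show ?thesis ..
qed

text \<open>
  The loops are disjoint, so no level segment is counted twice. In particular the chain does not
  depend on how the segments are arranged to loops.
\<close>
lemma D3_eq_sum_level_segments:
  assumes \<Gamma>: "level_loops Ts \<epsilon> \<phi> \<Gamma>"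
  shows "D3 h \<Gamma> = (\<Sum>(p, q)\<in>level_segments Ts \<epsilon> \<phi>. straight h [p, q])"
proof -
  have "loop_sides ps \<inter> loop_sides qs = {}" if ps: "ps \<in> \<Gamma>" "qs \<in> \<Gamma>" "ps \<noteq> qs" for ps qs
  proof (rule ccontr)
    assume "loop_sides ps \<inter> loop_sides qs \<noteq> {}"
    then obtain p q where "(p, q) \<in> loop_sides ps" "(p, q) \<in> loop_sides qs"
      by auto
    then have "p \<in> loop_image ps" "p \<in> loop_image qs"
      unfolding loop_image_def by auto
    then show False
      using \<Gamma> ps unfolding level_loops_def by blast
  qed
  then have "(\<Sum>(p, q)\<in>(\<Union>ps\<in>\<Gamma>. loop_sides ps). straight h [p, q]) = D3 h \<Gamma>"
    unfolding D3_def loop_chain_def using \<Gamma>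
    by (intro sum.UNION_disjoint) (auto simp: level_loops_def loop_sides_def)
  then show ?thesis
    using \<Gamma> by (simp add: level_loops_def)
qed

lemma sum_crossings:
  assumes T: "T \<in> Ts"
  shows "(\<Sum>x\<in>crossings T \<sigma>. f x) =
    (\<Sum>S\<in>edges_of T. if \<epsilon> T * incidence S T * sgn (\<phi> S) = \<sigma> then \<Sum>x\<in>level_points \<phi> S. f x else (0::'b::ab_group_add))"
proof -
  have "(\<Sum>x\<in>crossings T \<sigma>. f x) =
      (\<Sum>S\<in>{S \<in> edges_of T. \<epsilon> T * incidence S T * sgn (\<phi> S) = \<sigma>}. \<Sum>x\<in>level_points \<phi> S. f x)"
    unfolding edge_crossings_def
  proof (rule sum.UNION_disjoint)
    show "finite {S \<in> edges_of T. \<epsilon> T * incidence S T * sgn (\<phi> S) = \<sigma>}"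
      using finite_edges_of[of T] by simp
  qed (use finite_level_points level_point_edge_unique[OF T _ T] in blast)+
  then show ?thesis
    using finite_edges_of[of T] by (simp add: sum.inter_filter)
qed

text \<open>
  A level segment from \<open>p\<close> to \<open>q\<close> in \<open>T\<close> is homologous to the difference of the spokes to \<open>q\<close> and \<open>p\<close>.
  The spokes to the end points and start points in \<open>T\<close> are the spokes to the points where the altitude
  falls and rises along the oriented boundary, and these signs are those of the spread.
\<close>
theorem D3_homologous_spread:
  assumes \<Gamma>: "level_loops Ts \<epsilon> \<phi> \<Gamma>"
  shows "homologous_rel 1 X {} (D3 h \<Gamma>) (spread (level_points \<phi>) (\<lambda>S x. sgn (\<phi> S)))"
proof -
  have "D3 h \<Gamma> = (\<Sum>T\<in>Ts. \<Sum>(p, q)\<in>segs T. straight h [p, q])"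
    unfolding D3_eq_sum_level_segments[OF \<Gamma>] level_segments_UN
    by (intro sum.UNION_disjoint ballI impI finite_triangles finite_segs) (use segs_disjoint in blast)+
  moreover have "homologous_rel 1 X {} (\<Sum>T\<in>Ts. \<Sum>(p, q)\<in>segs T. straight h [p, q])
      (\<Sum>T\<in>Ts. \<Sum>y\<in>segs T. spoke T (snd y) - spoke T (fst y))"
  proof (intro homologous_sum finite_triangles finite_segs)
    fix T y assume T: "T \<in> Ts" and y: "y \<in> segs T"
    obtain p q where pq: "y = (p, q)"
      by (cases y)
    have "closed_segment p q \<subseteq> triangle_hull T"
      using segs_geometry(2)[OF T] y pq by simp
    then have "p \<in> triangle_hull T" "q \<in> triangle_hull T"
      by auto
    then show "homologous_rel 1 X {} (case y of (p, q) \<Rightarrow> straight h [p, q]) (spoke T (snd y) - spoke T (fst y))"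
      using homologous_spoke_difference[OF T] by (simp add: pq)
  qed
  moreover have "(\<Sum>T\<in>Ts. \<Sum>y\<in>segs T. spoke T (snd y) - spoke T (fst y)) =
      spread (level_points \<phi>) (\<lambda>S x. sgn (\<phi> S))"
  proof -
    have "(\<Sum>y\<in>segs T. spoke T (snd y) - spoke T (fst y)) = - (\<Sum>S\<in>edges_of T.
        frag_cmul (\<epsilon> T * incidence S T) (\<Sum>x\<in>level_points \<phi> S. frag_cmul (sgn (\<phi> S)) (spoke T x)))"
      if T: "T \<in> Ts" for T
    proof -
      let ?G = "\<lambda>S. \<Sum>x\<in>level_points \<phi> S. spoke T x" and ?c = "\<lambda>S. \<epsilon> T * incidence S T * sgn (\<phi> S)"
      have "(\<Sum>y\<in>segs T. spoke T (snd y) - spoke T (fst y)) =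
          (\<Sum>x\<in>crossings T (- 1). spoke T x) - (\<Sum>x\<in>crossings T 1. spoke T x)"
        unfolding sum_subtractf
        using sum.reindex_bij_betw[OF bij_betw_segs(1)[OF T], of "spoke T"]
          sum.reindex_bij_betw[OF bij_betw_segs(2)[OF T], of "spoke T"] by simp
      also have "\<dots> = (\<Sum>S\<in>edges_of T. (if ?c S = - 1 then ?G S else 0) - (if ?c S = 1 then ?G S else 0))"
        unfolding sum_crossings[OF T] sum_subtractf ..
      also have "\<dots> = (\<Sum>S\<in>edges_of T. - frag_cmul (?c S) (?G S))"
      proof (intro sum.cong refl)
        fix S assume S: "S \<in> edges_of T"
        have "?c S \<in> {1, - 1, 0}"
          using incidence_sign[OF T S] by (auto simp: sgn_if)
        then show "(if ?c S = - 1 then ?G S else 0) - (if ?c S = 1 then ?G S else 0) = - frag_cmul (?c S) (?G S)"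
          by (elim insertE) simp_all
      qed
      finally show ?thesis
        by (simp only: sum_negf frag_cmul_sum frag_cmul_cmul mult.assoc)
    qed
    then show ?thesis
      unfolding spread_def sum_negf[symmetric] by (rule sum.cong[OF refl])
  qed
  ultimately show ?thesis
    by simp
qed

theorem D2_homologous_D3:
  assumes \<Gamma>: "level_loops Ts \<epsilon> \<phi> \<Gamma>"
  shows "homologous_rel 1 X {} (D2 h Ts \<epsilon> \<phi>) (D3 h \<Gamma>)"
proof -
  have "homologous_rel 1 X {} (D2 h Ts \<epsilon> \<phi>) (spread (level_points \<phi>) (\<lambda>S x. sgn (\<phi> S)))"
  proof (rule D2_homologous_spread[OF \<phi>])
    fix S T assume T: "T \<in> Ts" "S \<in> edges_of T"
    show "finite (level_points \<phi> S) \<and> level_points \<phi> S \<subseteq> closed_segment (fst S) (snd S) \<and>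
        (\<Sum>x\<in>level_points \<phi> S. sgn (\<phi> S)) = \<phi> S"
      using finite_level_points[of \<phi> S] sum_level_points[OF edgeD(1)[OF T], of \<phi>]
        level_points_open_segment[OF edgeD(1)[OF T], of \<phi>] open_closed_segment
      by blast
  qed
  then show ?thesis
    using homologous_rel_trans[of 1 X "{}" _ "D3 h \<Gamma>"] D3_homologous_spread[OF \<Gamma>] homologous_rel_sym
    by blast
qed

end

end

theorem proposition5p1:
  fixes X :: "'a topology"
    and K :: "'e::euclidean_space set set"
    and h :: "'e \<Rightarrow> 'a"
    and r :: "('e \<times> 'e) set"
    and \<epsilon> :: "'e \<times> 'e \<times> 'e \<Rightarrow> int"
  assumes "compact_space X" and "topological_manifold 2 X"
    and "simplicial_complex K" and "homeomorphic_map (top_of_set (\<Union>K)) X h"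
    and "linear_order_on (vertices K) r"
    and "\<forall>T \<in> triangles K r. \<epsilon> T \<in> {1, - 1}"
    and "singular_relcycle 2 X {} (fundamental_chain h (triangles K r) \<epsilon>)"
  shows "\<forall>\<phi> \<in> cocycles (triangles K r).
    singular_relcycle 1 X {} (D1 h (triangles K r) \<epsilon> \<phi>) \<and>
    singular_relcycle 1 X {} (D2 h (triangles K r) \<epsilon> \<phi>) \<and>
    homologous_rel_set 1 X {} (D1 h (triangles K r) \<epsilon> \<phi>) =
      homologous_rel_set 1 X {} (D2 h (triangles K r) \<epsilon> \<phi>) \<and>
    (\<exists>\<Gamma>. level_loops (triangles K r) \<epsilon> \<phi> \<Gamma>) \<and>
    (\<forall>\<Gamma>. level_loops (triangles K r) \<epsilon> \<phi> \<Gamma> \<longrightarrow>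
       singular_relcycle 1 X {} (D3 h \<Gamma>) \<and>
       homologous_rel_set 1 X {} (D2 h (triangles K r) \<epsilon> \<phi>) =
         homologous_rel_set 1 X {} (D3 h \<Gamma>))"
proof -
  interpret ordered_complex K r
    using assms(3,5) by (rule ordered_complex.intro)
  interpret triangle_system X "\<Union>K" h "triangles K r" \<epsilon>
  proof
    show "continuous_map (top_of_set (\<Union>K)) X h"
      by (rule homeomorphic_imp_continuous_map[OF assms(4)])
    show "finite (triangles K r)"
      by (rule finitely_many_triangles)
    show "distinct [v0, v1, v2]" if "(v0, v1, v2) \<in> triangles K r" for v0 v1 v2
      using triangleD(2-4)[OF that] by simp
    show "triangle_hull T \<subseteq> \<Union>K" if "T \<in> triangles K r" for T
      using triangle_hull_in_complex[OF that] by blast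
  qed
  have "inj_on h (\<Union>K)"
    using homeomorphic_imp_injective_map[OF assms(4)] by simp
  moreover have "chain_boundary 2 (fundamental_chain h (triangles K r) \<epsilon>) = 0"
    using assms(7) by (simp add: singular_cycle)
  ultimately interpret triangulated_surface X K h r \<epsilon>
    using assms(2,4,6) balanced_of_fundamental_cycle by unfold_locales blast+
  show ?thesis
  proof (intro ballI conjI allI impI)
    fix \<phi> assume \<phi>: "\<phi> \<in> cocycles (triangles K r)"
    note D12 = D1_homologous_D2[OF \<phi>]
    show D2: "singular_relcycle 1 X {} (D2 h (triangles K r) \<epsilon> \<phi>)"
      by (rule singular_relcycle_D2[OF \<phi>])
    show "singular_relcycle 1 X {} (D1 h (triangles K r) \<epsilon> \<phi>)"
      using homologous_rel_singular_relcycle[OF D12] D2 by blast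
    show "homologous_rel_set 1 X {} (D1 h (triangles K r) \<epsilon> \<phi>) =
        homologous_rel_set 1 X {} (D2 h (triangles K r) \<epsilon> \<phi>)"
      using D12 by (simp only: homologous_rel_set_eq)
    show "\<exists>\<Gamma>. level_loops (triangles K r) \<epsilon> \<phi> \<Gamma>"
      by (rule level_loops_exist[OF \<phi>])
    fix \<Gamma> assume \<Gamma>: "level_loops (triangles K r) \<epsilon> \<phi> \<Gamma>"
    note D23 = D2_homologous_D3[OF \<phi> \<Gamma>]
    show "singular_relcycle 1 X {} (D3 h \<Gamma>)"
      using homologous_rel_singular_relcycle[OF D23] D2 by blast
    show "homologous_rel_set 1 X {} (D2 h (triangles K r) \<epsilon> \<phi>) = homologous_rel_set 1 X {} (D3 h \<Gamma>)"
      using D23 by (simp only: homologous_rel_set_eq)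
  qed
qed

end
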